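(* Fix a field and a degree $d\ge0$. Let $(\Phi,M)$ be an incarnation of a data set $\Phi$ consisting of measurements on $X$, and let $(\Phi,M,E_{\Phi,M})$ be its associated Grothendieck graph. Then the collection of objects $\{PH_d^\Phi(\phi)\mid\phi\in\Phi\}$ and the collection of morphisms $$\{PH_d^{-g}(\phi)\colon PH_d^\Phi(\phi g)\to PH_d^\Phi(\phi)\mid (\phi,g,\phi g)\in E_{\Phi,M}\}$$ in $\mathrm{Tame}([0,\infty)\times\mathbf{R},\mathrm{Vect})$ form a (contravariant) functor $PH_d^\Phi\colon(\Phi,M,E_{\Phi,M})\to\mathrm{Tame}([0,\infty)\times\mathbf{R},\mathrm{Vect})$ indexed by the Grothendieck graph $(\Phi,M,E_{\Phi,M})$.
   Context: A data set is a finite set $\Phi=\{\phi_i\colon X\to\mathbf{R}\mid i=1,\dots,m\}$ of real-valued functions (measurements) on a finite set $X$, called its domain. It induces the pseudometric $d_\Phi(x,y)=\max_{i}|\phi_i(x)-\phi_i(y)|$ on $X$. Let $\mathrm{End}_\Phi(X)$ be the monoid (under composition) of functions $g\colon X\to X$ such that $\phi g\in\Phi$ for all $\phi\in\Phi$, where $\phi g=\phi\circ g$. An incarnation of $\Phi$ is a pair $(\Phi,M)$ with $M\subset\mathrm{End}_\Phi(X)$ a subset (not necessarily a submonoid). A Grothendieck graph is a triple $(V,M,E)$ with $V$, $M$ finite sets and $E\subset V\times M\times V$ such that for every $v\in V$ and $g\in M$ there is a unique element of $V$, denoted $vg$, with $(v,g,vg)\in E$. The Grothendieck graph associated to $(\Phi,M)$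 is $(\Phi,M,E_{\Phi,M})$ with $E_{\Phi,M}=\{(\phi,g,\psi)\in\Phi\times M\times\Phi\mid\phi g=\psi\}$. A contravariant functor $P\colon(V,M,E)\to\mathcal{C}$ indexed by a Grothendieck graph $(V,M,E)$ with values in a category $\mathcal{C}$ is a collection of objects $P(v)$, $v\in V$, and a collection of morphisms $P(v_0,g,v_1)\colon P(v_1)\to P(v_0)$, one for each $(v_0,g,v_1)\in E$, subject to: if $(v_0,g_0,v_1)$, $(v_1,g_1,v_2)$ and $(v_0,h,v_2)$ are edges in $E$, then $P(v_0,h,v_2)=P(v_0,g_0,v_1)\,P(v_1,g_1,v_2)$. In the claim, the object at $\phi$ is $PH_d^\Phi(\phi)$ and the morphism at the edge $(\phi,g,\phi g)$ is $PH_d^{-g}(\phi)$. For $\phi\in\Phi$, $s\in\mathbf{R}$, $r\ge0$, write $(\phi\le s):=\phi^{-1}((-\infty,s])$, and let $\mathrm{VR}_r(\phi\le s,d_\Phi)$ be the Vietoris-Rips complex whose simplices are the (nonempty) subsets of $(\phi\le s)$ of $d_\Phi$-diameter at most $r$. Set $PH_d^\Phi(\phi)_{r,s}:=H_d(\mathrm{VR}_r(\phi\le s,d_\Phi))$ (homology with coefficients in the fixed field); with maps induced by inclusions this is a functor $PH_d^\Phi(\phi)$ from the poset $[0,\infty)\times\mathbf{R}$ to vector spaces. For $g\in M$, the function $g\colon X\to X$ is non-expansive for $d_\Phi$ and maps $(\phi g\le s)$ into $(\phi\le s)$, hence induces simplicial maps $\mathrm{VR}_r(\phi g\le s,d_\Phi)\to\mathrm{VR}_r(\phi\le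 s,d_\Phi)$; the induced maps on $H_d$ form the morphism $PH_d^{-g}(\phi)\colon PH_d^\Phi(\phi g)\to PH_d^\Phi(\phi)$. A functor $P$ from the poset $[0,\infty)\times\mathbf{R}$ to vector spaces is tame if its values are finite dimensional and there are finite sequences $0=r_0<r_1<\cdots<r_m=\infty$ and $s_0<s_1<\cdots<s_l=\infty$ such that $P$ restricted to each $[r_i,r_{i+1})\times(-\infty,s_0)$ and each $[r_i,r_{i+1})\times[s_j,s_{j+1})$ is constant (all transition maps within the block are isomorphisms). $\mathrm{Tame}([0,\infty)\times\mathbf{R},\mathrm{Vect})$ is the category of such functors with natural transformations as morphisms.
   Formalization: The composition law is false for all edge triples (a swap fixing a measurement would have to be idempotent on H_0); it is stated only for triples in which h acts on every measurement in Φ as g_0 followed by g_1, which includes h = g_0∘g_1. *)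

theory Defs
  imports
    "Jordan_Normal_Form.VS_Connect"
    "HOL-Algebra.AbelCoset"
    "HOL-Library.FuncSet"
    "HOL-Library.Extended_Real"
begin

section \<open>Categories\<close>

text \<open>Composition takes the three objects as arguments, since morphisms do not carry their
  domains: \<open>Cmp C a b c g f\<close> is \<open>g \<circ> f\<close> for \<open>f : a \<rightarrow> b\<close> and \<open>g : b \<rightarrow> c\<close>.\<close>

record ('o, 'm) precategory =
  Ob :: "'o set"
  Hom :: "'o \<Rightarrow> 'o \<Rightarrow> 'm set"
  Id :: "'o \<Rightarrow> 'm"
  Cmp :: "'o \<Rightarrow> 'o \<Rightarrow> 'o \<Rightarrow> 'm \<Rightarrow> 'm \<Rightarrow> 'm"

locale category =
  fixes C :: "('o, 'm) precategory"
  assumes Id_in_Hom: "a \<in> Ob C \<Longrightarrow> Id C a \<in> Hom C a a"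
    and Cmp_in_Hom: "\<lbrakk>a \<in> Ob C; b \<in> Ob C; c \<in> Ob C; f \<in> Hom C a b; g \<in> Hom C b c\<rbrakk>
      \<Longrightarrow> Cmp C a b c g f \<in> Hom C a c"
    and Cmp_Id: "\<lbrakk>a \<in> Ob C; b \<in> Ob C; f \<in> Hom C a b\<rbrakk> \<Longrightarrow> Cmp C a a b f (Id C a) = f"
    and Id_Cmp: "\<lbrakk>a \<in> Ob C; b \<in> Ob C; f \<in> Hom C a b\<rbrakk> \<Longrightarrow> Cmp C a b b (Id C b) f = f"
    and Cmp_assoc: "\<lbrakk>a \<in> Ob C; b \<in> Ob C; c \<in> Ob C; e \<in> Ob C;
        f \<in> Hom C a b; g \<in> Hom C b c; h \<in> Hom C c e\<rbrakk>
      \<Longrightarrow> Cmp C a c e h (Cmp C a b c g f) = Cmp C a b e (Cmp C b c e h g) f"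

definition is_iso :: "('o, 'm) precategory \<Rightarrow> 'o \<Rightarrow> 'o \<Rightarrow> 'm \<Rightarrow> bool" where
  "is_iso C a b f \<longleftrightarrow> f \<in> Hom C a b \<and>
     (\<exists>g\<in>Hom C b a. Cmp C a b a g f = Id C a \<and> Cmp C b a b f g = Id C b)"

text \<open>Vector spaces over the field \<open>'k\<close> with carrier in a fixed type \<open>'v\<close>. Linear maps are
  extensional, i.e. \<open>undefined\<close> off the carrier, so that equality of morphisms is the equality
  of linear maps.\<close>

definition Vect :: "(('k::field, 'v) module, 'v \<Rightarrow> 'v) precategory" where
  "Vect = \<lparr>
     Ob = {V. vectorspace class_ring V},
     Hom = (\<lambda>V W. LinearCombinations.module_hom class_ring V W \<inter> extensional (carrier V)),
     Id = (\<lambda>V. \<lambda>x\<in>carrier V. x),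
     Cmp = (\<lambda>U V W g f. compose (carrier U) g f)\<rparr>"

section \<open>Functors on the poset of pairs (r, s) and tameness\<close>

definition par :: "(real \<times> real) set" where
  "par = {0..} \<times> UNIV"

definition par_le :: "real \<times> real \<Rightarrow> real \<times> real \<Rightarrow> bool" where
  "par_le p q \<longleftrightarrow> fst p \<le> fst q \<and> snd p \<le> snd q"

record ('o, 'm) par_diagram =
  obj :: "real \<times> real \<Rightarrow> 'o"
  tr :: "real \<times> real \<Rightarrow> real \<times> real \<Rightarrow> 'm"

definition par_functor :: "('o, 'm) precategory \<Rightarrow> ('o, 'm) par_diagram \<Rightarrow> bool" where
  "par_functor C P \<longleftrightarrow>
     (\<forall>p\<in>par. obj P p \<in> Ob C) \<and>
     (\<forall>p\<in>par. \<forall>q\<in>par. par_le p q \<longrightarrow> tr P p q \<in> Hom C (obj P p) (obj P q)) \<and>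
     (\<forall>p\<in>par. tr P p p = Id C (obj P p)) \<and>
     (\<forall>p\<in>par. \<forall>q\<in>par. \<forall>t\<in>par. par_le p q \<longrightarrow> par_le q t \<longrightarrow>
        tr P p t = Cmp C (obj P p) (obj P q) (obj P t) (tr P q t) (tr P p q))"

definition nat_trans ::
  "('o, 'm) precategory \<Rightarrow> ('o, 'm) par_diagram \<Rightarrow> ('o, 'm) par_diagram \<Rightarrow> (real \<times> real \<Rightarrow> 'm) set"
where
  "nat_trans C P Q = {\<eta> \<in> extensional par.
     (\<forall>p\<in>par. \<eta> p \<in> Hom C (obj P p) (obj Q p)) \<and>
     (\<forall>p\<in>par. \<forall>q\<in>par. par_le p q \<longrightarrow>
        Cmp C (obj P p) (obj P q) (obj Q q) (\<eta> q) (tr P p q) =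
        Cmp C (obj P p) (obj Q p) (obj Q q) (tr Q p q) (\<eta> p))}"

definition block :: "ereal \<Rightarrow> ereal \<Rightarrow> ereal \<Rightarrow> ereal \<Rightarrow> (real \<times> real) set" where
  "block a b c e = {(r, s). a \<le> ereal r \<and> ereal r < b \<and> c \<le> ereal s \<and> ereal s < e}"

definition constant_on ::
  "('o, 'm) precategory \<Rightarrow> ('o, 'm) par_diagram \<Rightarrow> (real \<times> real) set \<Rightarrow> bool"
where
  "constant_on C P B \<longleftrightarrow>
     (\<forall>p\<in>B. \<forall>q\<in>B. par_le p q \<longrightarrow> is_iso C (obj P p) (obj P q) (tr P p q))"

text \<open>The sequences are \<open>r 0 < \<dots> < r m\<close> and \<open>s 0 < \<dots> < s l\<close>; the block with lower
  second bound \<open>-\<infinity>\<close> is \<open>[r i, r (i+1)) \<times> (-\<infinity>, s 0)\<close>.\<close>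

definition tame :: "(('k::field, 'v) module, 'v \<Rightarrow> 'v) par_diagram \<Rightarrow> bool" where
  "tame P \<longleftrightarrow>
     (\<forall>p\<in>par. vectorspace.fin_dim class_ring (obj P p)) \<and>
     (\<exists>(m::nat) (l::nat) (r :: nat \<Rightarrow> ereal) (s :: nat \<Rightarrow> ereal).
        strict_mono_on {..m} r \<and> r 0 = 0 \<and> r m = \<infinity> \<and>
        strict_mono_on {..l} s \<and> s 0 \<noteq> -\<infinity> \<and> s l = \<infinity> \<and>
        (\<forall>i<m. constant_on Vect P (block (r i) (r (Suc i)) (-\<infinity>) (s 0)) \<and>
          (\<forall>j<l. constant_on Vect P (block (r i) (r (Suc i)) (s j) (s (Suc j))))))"

definition Tame ::
  "((('k::field, 'v) module, 'v \<Rightarrow> 'v) par_diagram, real \<times> real \<Rightarrow> 'v \<Rightarrow> 'v) precategory"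
where
  "Tame = \<lparr>
     Ob = {P. par_functor Vect P \<and> tame P},
     Hom = nat_trans Vect,
     Id = (\<lambda>P. \<lambda>p\<in>par. Id Vect (obj P p)),
     Cmp = (\<lambda>P Q R \<eta> \<theta>. \<lambda>p\<in>par. Cmp Vect (obj P p) (obj Q p) (obj R p) (\<eta> p) (\<theta> p))\<rparr>"

section \<open>Simplicial homology with field coefficients\<close>

text \<open>A simplicial complex is given by its set of nonempty simplices. Homology is computed from
  the ordered chain complex: the \<open>n\<close>-chains are the finitely supported functions on the lists
  \<open>[v\<^sub>0, \<dots>, v\<^sub>n]\<close> (repetitions allowed) whose entries span a simplex. This is the version of
  the simplicial chain complex which is functorial without a choice of orientations.\<close>

definition chains :: "'x set set \<Rightarrow> nat \<Rightarrow> ('x list \<Rightarrow> 'k::field) set" where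
  "chains K n = {c. finite {w. c w \<noteq> 0} \<and> (\<forall>w. c w \<noteq> 0 \<longrightarrow> length w = Suc n \<and> set w \<in> K)}"

definition face :: "nat \<Rightarrow> 'x list \<Rightarrow> 'x list" where
  "face i w = take i w @ drop (Suc i) w"

definition boundary :: "nat \<Rightarrow> ('x list \<Rightarrow> 'k::field) \<Rightarrow> 'x list \<Rightarrow> 'k" where
  "boundary n c = (if n = 0 then (\<lambda>_. 0) else
     (\<lambda>u. \<Sum>w | c w \<noteq> 0. \<Sum>i\<le>n. if face i w = u then (-1) ^ i * c w else 0))"

definition cycles :: "'x set set \<Rightarrow> nat \<Rightarrow> ('x list \<Rightarrow> 'k::field) set" where
  "cycles K n = {c \<in> chains K n. boundary n c = (\<lambda>_. 0)}"

definition boundaries :: "'x set set \<Rightarrow> nat \<Rightarrow> ('x list \<Rightarrow> 'k::field) set" where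
  "boundaries K n = boundary (Suc n) ` chains K (Suc n)"

definition function_space :: "('a \<Rightarrow> 'k) set \<Rightarrow> ('k::field, 'a \<Rightarrow> 'k) module" where
  "function_space S = \<lparr>carrier = S, mult = undefined, one = undefined,
     zero = (\<lambda>_. 0), add = (\<lambda>f g x. f x + g x), smult = (\<lambda>a f x. a * f x)\<rparr>"

definition quotient_space :: "('k::field, 'v) module \<Rightarrow> 'v set \<Rightarrow> ('k, 'v set) module" where
  "quotient_space V B = \<lparr>carrier = a_rcosets\<^bsub>V\<^esub> B, mult = undefined, one = undefined,
     zero = B, add = (\<lambda>S T. S <+>\<^bsub>V\<^esub> T), smult = (\<lambda>a S. B <+>\<^bsub>V\<^esub> (\<lambda>v. a \<odot>\<^bsub>V\<^esub> v) ` S)\<rparr>"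

definition homology :: "nat \<Rightarrow> 'x set set \<Rightarrow> ('k::field, ('x list \<Rightarrow> 'k) set) module" where
  "homology d K = quotient_space (function_space (cycles K d)) (boundaries K d)"

text \<open>The chain map sends \<open>[v\<^sub>0, \<dots>, v\<^sub>n]\<close> to \<open>[f v\<^sub>0, \<dots>, f v\<^sub>n]\<close>, and
  \<open>homology_map d K L f\<close> sends the class of a cycle in \<open>K\<close> to the class in \<open>L\<close> of its image.\<close>

definition chain_map :: "('x \<Rightarrow> 'x) \<Rightarrow> ('x list \<Rightarrow> 'k::field) \<Rightarrow> 'x list \<Rightarrow> 'k" where
  "chain_map f c = (\<lambda>u. \<Sum>w | c w \<noteq> 0 \<and> map f w = u. c w)"

definition homology_map ::
  "nat \<Rightarrow> 'x set set \<Rightarrow> 'x set set \<Rightarrow> ('x \<Rightarrow> 'x)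
     \<Rightarrow> ('x list \<Rightarrow> 'k::field) set \<Rightarrow> ('x list \<Rightarrow> 'k) set"
where
  "homology_map d K L f = (\<lambda>S\<in>carrier (homology d K).
     boundaries L d <+>\<^bsub>function_space (cycles L d)\<^esub> chain_map f ` S)"

section \<open>Data sets and persistent homology\<close>

text \<open>Functions with domain \<open>X\<close> are \<open>undefined\<close> off \<open>X\<close>, so that \<open>\<phi>g\<close> is
  \<open>compose X \<phi> g\<close>.\<close>

definition data_set :: "'x set \<Rightarrow> ('x \<Rightarrow> real) set \<Rightarrow> bool" where
  "data_set X \<Phi> \<longleftrightarrow> finite X \<and> finite \<Phi> \<and> \<Phi> \<subseteq> X \<rightarrow>\<^sub>E UNIV"

definition data_dist :: "('x \<Rightarrow> real) set \<Rightarrow> 'x \<Rightarrow> 'x \<Rightarrow> real" where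
  "data_dist \<Phi> x y = Max ((\<lambda>\<phi>. \<bar>\<phi> x - \<phi> y\<bar>) ` \<Phi>)"

definition data_endos :: "'x set \<Rightarrow> ('x \<Rightarrow> real) set \<Rightarrow> ('x \<Rightarrow> 'x) set" where
  "data_endos X \<Phi> = {g \<in> X \<rightarrow>\<^sub>E X. \<forall>\<phi>\<in>\<Phi>. compose X \<phi> g \<in> \<Phi>}"

definition incarnation :: "'x set \<Rightarrow> ('x \<Rightarrow> real) set \<Rightarrow> ('x \<Rightarrow> 'x) set \<Rightarrow> bool" where
  "incarnation X \<Phi> M \<longleftrightarrow> data_set X \<Phi> \<and> M \<subseteq> data_endos X \<Phi>"

definition vietoris_rips :: "'x set \<Rightarrow> ('x \<Rightarrow> 'x \<Rightarrow> real) \<Rightarrow> real \<Rightarrow> 'x set set" where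
  "vietoris_rips Y \<delta> r = {\<sigma>. \<sigma> \<noteq> {} \<and> finite \<sigma> \<and> \<sigma> \<subseteq> Y \<and> (\<forall>x\<in>\<sigma>. \<forall>y\<in>\<sigma>. \<delta> x y \<le> r)}"

definition sublevel_VR ::
  "'x set \<Rightarrow> ('x \<Rightarrow> real) set \<Rightarrow> ('x \<Rightarrow> real) \<Rightarrow> real \<times> real \<Rightarrow> 'x set set"
where
  "sublevel_VR X \<Phi> \<phi> = (\<lambda>(r, s). vietoris_rips {x \<in> X. \<phi> x \<le> s} (data_dist \<Phi>) r)"

definition PH ::
  "nat \<Rightarrow> 'x set \<Rightarrow> ('x \<Rightarrow> real) set \<Rightarrow> ('x \<Rightarrow> real)
     \<Rightarrow> (('k::field, ('x list \<Rightarrow> 'k) set) module,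
         ('x list \<Rightarrow> 'k) set \<Rightarrow> ('x list \<Rightarrow> 'k) set) par_diagram"
where
  "PH d X \<Phi> \<phi> = \<lparr>
     obj = (\<lambda>p. homology d (sublevel_VR X \<Phi> \<phi> p)),
     tr = (\<lambda>p q. homology_map d (sublevel_VR X \<Phi> \<phi> p) (sublevel_VR X \<Phi> \<phi> q) (\<lambda>x. x))\<rparr>"

definition PH_map ::
  "nat \<Rightarrow> 'x set \<Rightarrow> ('x \<Rightarrow> real) set \<Rightarrow> ('x \<Rightarrow> 'x) \<Rightarrow> ('x \<Rightarrow> real)
     \<Rightarrow> real \<times> real \<Rightarrow> ('x list \<Rightarrow> 'k::field) set \<Rightarrow> ('x list \<Rightarrow> 'k) set"
where
  "PH_map d X \<Phi> g \<phi> = (\<lambda>p\<in>par.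
     homology_map d (sublevel_VR X \<Phi> (compose X \<phi> g) p) (sublevel_VR X \<Phi> \<phi> p) g)"

section \<open>Grothendieck graphs and functors indexed by them\<close>

locale grothendieck_graph =
  fixes V :: "'v set" and M :: "'g set" and E :: "('v \<times> 'g \<times> 'v) set"
  assumes finite_V: "finite V"
    and finite_M: "finite M"
    and edges: "E \<subseteq> V \<times> M \<times> V"
    and unique_target: "\<lbrakk>v \<in> V; g \<in> M\<rbrakk> \<Longrightarrow> \<exists>!w. w \<in> V \<and> (v, g, w) \<in> E"

definition assoc_edges ::
  "'x set \<Rightarrow> ('x \<Rightarrow> real) set \<Rightarrow> ('x \<Rightarrow> 'x) set
     \<Rightarrow> (('x \<Rightarrow> real) \<times> ('x \<Rightarrow> 'x) \<times> ('x \<Rightarrow> real)) set"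
where
  "assoc_edges X \<Phi> M = {(\<phi>, g, \<psi>) \<in> \<Phi> \<times> M \<times> \<Phi>. compose X \<phi> g = \<psi>}"

locale graph_diagram = grothendieck_graph V M E + category C
  for V :: "'v set" and M :: "'g set" and E :: "('v \<times> 'g \<times> 'v) set"
    and C :: "('o, 'm) precategory" +
  fixes F :: "'v \<Rightarrow> 'o" and T :: "'v \<times> 'g \<times> 'v \<Rightarrow> 'm"
  assumes object: "v \<in> V \<Longrightarrow> F v \<in> Ob C"
    and morphism: "(v, g, w) \<in> E \<Longrightarrow> T (v, g, w) \<in> Hom C (F w) (F v)"

text \<open>\<open>h\<close> acts on the graph as \<open>g\<^sub>0\<close> followed by \<open>g\<^sub>1\<close>: \<open>vh = (vg\<^sub>0)g\<^sub>1\<close> for all vertices.\<close>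

definition acts_as_composite ::
  "'v set \<Rightarrow> ('v \<times> 'g \<times> 'v) set \<Rightarrow> 'g \<Rightarrow> 'g \<Rightarrow> 'g \<Rightarrow> bool"
where
  "acts_as_composite V E g0 g1 h \<longleftrightarrow>
     (\<forall>v0\<in>V. \<forall>v1\<in>V. \<forall>v2\<in>V. (v0, g0, v1) \<in> E \<longrightarrow> (v1, g1, v2) \<in> E \<longrightarrow> (v0, h, v2) \<in> E)"

text \<open>The composition law is imposed on those triples of edges whose label \<open>h\<close> acts as the
  composite of the labels \<open>g\<^sub>0\<close>, \<open>g\<^sub>1\<close>. If it were imposed on all edges
  \<open>(v\<^sub>0, g\<^sub>0, v\<^sub>1)\<close>, \<open>(v\<^sub>1, g\<^sub>1, v\<^sub>2)\<close>, \<open>(v\<^sub>0, h, v\<^sub>2)\<close>, then a label \<open>g\<close> fixing a vertex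
  would have to give an idempotent there, which persistent homology violates; see
  \<open>unrestricted_law_fails\<close> below.\<close>

locale contravariant_graph_functor = graph_diagram +
  assumes composition:
    "\<lbrakk>(v0, g0, v1) \<in> E; (v1, g1, v2) \<in> E; (v0, h, v2) \<in> E; acts_as_composite V E g0 g1 h\<rbrakk>
      \<Longrightarrow> T (v0, h, v2) = Cmp C (F v2) (F v1) (F v0) (T (v0, g0, v1)) (T (v1, g1, v2))"

text \<open>In the graph of an incarnation, actual composites of endomorphisms are covered.\<close>

lemma acts_as_composite_compose:
  assumes "incarnation X \<Phi> M" "g0 \<in> M" "g1 \<in> M" "compose X g0 g1 \<in> M"
  shows "acts_as_composite \<Phi> (assoc_edges X \<Phi> M) g0 g1 (compose X g0 g1)"
proof -
  have "g1 \<in> X \<rightarrow> X"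
    using assms by (auto simp: incarnation_def data_endos_def)
  then have "compose X \<phi> (compose X g0 g1) = compose X (compose X \<phi> g0) g1" for \<phi>
    by (auto simp: compose_def fun_eq_iff restrict_def Pi_def)
  then show ?thesis
    using assms by (auto simp: acts_as_composite_def assoc_edges_def)
qed

lemma singleton_iff_all_eq: "\<sigma> \<noteq> {} \<and> (\<forall>x\<in>\<sigma>. \<forall>y\<in>\<sigma>. x = y) \<longleftrightarrow> (\<exists>a. \<sigma> = {a})"
  by (metis is_singletonE is_singletonI' insert_not_empty singletonD)

text \<open>With \<open>X = {False, True}\<close>, the measurements \<open>0\<close> and the two indicator functions, and
  the swap \<open>g\<close>, we have \<open>0g = 0\<close>, but \<open>g\<close> interchanges the two components of
  \<open>VR\<^sub>0(0 \<le> 0)\<close>, so the morphism at the edge \<open>(0, g, 0)\<close> is not idempotent.\<close>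

lemma unrestricted_law_fails:
  obtains \<Phi> :: "(bool \<Rightarrow> real) set" and M \<phi> g
  where "incarnation UNIV \<Phi> M" "(\<phi>, g, \<phi>) \<in> assoc_edges UNIV \<Phi> M"
    "(PH_map 0 UNIV \<Phi> g \<phi> :: _ \<Rightarrow> (bool list \<Rightarrow> 'k::field) set \<Rightarrow> _) \<noteq>
       Cmp Tame (PH 0 UNIV \<Phi> \<phi>) (PH 0 UNIV \<Phi> \<phi>) (PH 0 UNIV \<Phi> \<phi>)
         (PH_map 0 UNIV \<Phi> g \<phi>) (PH_map 0 UNIV \<Phi> g \<phi>)"
proof -
  define Z A B :: "bool \<Rightarrow> real" where "Z = (\<lambda>_. 0)" and "A = of_bool" and "B = (\<lambda>b. of_bool (\<not> b))"
  define \<Phi> where "\<Phi> = {Z, A, B}"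
  have swap: "compose UNIV Z Not = Z" "compose UNIV A Not = B" "compose UNIV B Not = A"
    by (auto simp: compose_def Z_def A_def B_def fun_eq_iff)
  have inc: "incarnation UNIV \<Phi> {Not}"
    using swap by (auto simp: incarnation_def data_set_def data_endos_def \<Phi>_def)
  have edge: "(Z, Not, Z) \<in> assoc_edges UNIV \<Phi> {Not}"
    using swap by (auto simp: assoc_edges_def \<Phi>_def)
  define K where "K = sublevel_VR UNIV \<Phi> Z (0, 0)"
  have dist: "data_dist \<Phi> x y \<le> 0 \<longleftrightarrow> x = y" for x y
    by (cases x; cases y) (auto simp: data_dist_def \<Phi>_def Z_def A_def B_def)
  have K: "\<sigma> \<in> K \<longleftrightarrow> (\<exists>a. \<sigma> = {a})" for \<sigma>
  proof -
    have "\<sigma> \<in> K \<longleftrightarrow> \<sigma> \<noteq> {} \<and> (\<forall>x\<in>\<sigma>. \<forall>y\<in>\<sigma>. x = y)"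
      by (simp add: K_def sublevel_VR_def vietoris_rips_def dist Z_def)
    then show ?thesis
      by (simp add: singleton_iff_all_eq)
  qed
  have bd: "boundary (Suc 0) c = (\<lambda>_. 0)" if c: "c \<in> chains K (Suc 0)" for c :: "bool list \<Rightarrow> 'k"
  proof -
    have "(\<Sum>i\<le>Suc 0. if face i w = u then (-1) ^ i * c w else 0) = 0" if "c w \<noteq> 0" for w u
    proof -
      have "length w = Suc (Suc 0)" "set w \<in> K"
        using c that by (auto simp: chains_def)
      then obtain a b where w: "w = [a, b]"
        by (auto simp: length_Suc_conv)
      with \<open>set w \<in> K\<close> have "a = b"
        by (auto simp: K)
      then show ?thesis
        by (simp add: w face_def)
    qed
    then show ?thesis
      by (simp add: boundary_def fun_eq_iff)
  qed
  have zero_chain: "(\<lambda>_. 0) \<in> chains K n" for n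
    by (simp add: chains_def)
  have bds: "boundaries K 0 = {(\<lambda>_. 0 :: 'k)}"
    using zero_chain[of "Suc 0"] bd unfolding boundaries_def by (auto simp: image_iff)
  define \<delta> :: "bool \<Rightarrow> bool list \<Rightarrow> 'k" where "\<delta> a = (\<lambda>w. if w = [a] then 1 else 0)" for a
  have \<delta>: "\<delta> a \<in> cycles K 0" for a
    by (auto simp: cycles_def chains_def boundary_def \<delta>_def K)
  have carr: "{\<delta> a} \<in> carrier (homology 0 K)" for a
    using \<delta>[of a]
    by (auto simp: homology_def quotient_space_def function_space_def A_RCOSETS_def RCOSETS_def
        r_coset_def bds)
  have chain: "chain_map Not (\<delta> a) = \<delta> (\<not> a)" for a
  proof
    fix u
    have "{w. \<delta> a w \<noteq> 0 \<and> map Not w = u} = (if u = [\<not> a] then {[a]} else {})"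
      by (auto simp: \<delta>_def)
    then show "chain_map Not (\<delta> a) u = \<delta> (\<not> a) u"
      by (auto simp: chain_map_def \<delta>_def)
  qed
  have map: "homology_map 0 K K Not {\<delta> a} = {\<delta> (\<not> a)}" for a
    using carr[of a]
    by (auto simp: homology_map_def chain bds function_space_def set_add_def set_mult_def)
  have p0: "(0, 0) \<in> par"
    by (simp add: par_def)
  have PHm: "PH_map 0 UNIV \<Phi> Not Z (0, 0) = (homology_map 0 K K Not :: (bool list \<Rightarrow> 'k) set \<Rightarrow> _)"
    using p0 by (simp add: PH_map_def swap K_def)
  have PHo: "obj (PH 0 UNIV \<Phi> Z) (0, 0) = (homology 0 K :: ('k, _) module)"
    by (simp add: PH_def K_def)
  have "\<delta> True \<noteq> \<delta> False"
    by (auto simp: \<delta>_def fun_eq_iff)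
  have "Cmp Tame (PH 0 UNIV \<Phi> Z) (PH 0 UNIV \<Phi> Z) (PH 0 UNIV \<Phi> Z)
         (PH_map 0 UNIV \<Phi> Not Z) (PH_map 0 UNIV \<Phi> Not Z) (0, 0) {\<delta> False} = {\<delta> False}"
    using p0 carr[of False] by (simp add: Tame_def Vect_def PHm PHo map compose_def)
  moreover have "PH_map 0 UNIV \<Phi> Not Z (0, 0) {\<delta> False} = {\<delta> True}"
    by (simp add: PHm map)
  ultimately have "(PH_map 0 UNIV \<Phi> Not Z :: _ \<Rightarrow> (bool list \<Rightarrow> 'k) set \<Rightarrow> _) \<noteq>
       Cmp Tame (PH 0 UNIV \<Phi> Z) (PH 0 UNIV \<Phi> Z) (PH 0 UNIV \<Phi> Z)
         (PH_map 0 UNIV \<Phi> Not Z) (PH_map 0 UNIV \<Phi> Not Z)"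
    using \<open>\<delta> True \<noteq> \<delta> False\<close> by (metis singleton_inject)
  with inc edge show ?thesis
    by (rule that)
qed

end

(* Tameness holds because only finitely many distances and function values occur, so that the
   Vietoris-Rips complexes, and hence their homology, are literally constant on the blocks cut out by
   these critical values. For the composition law, let h act on the measurements as g0 followed by
   g1. Then psi (h x) = psi (g0 (g1 x)) for all measurements psi, so h and g0 g1 are pointwise at
   distance 0. They may be different maps, but they are contiguous, and the prism operator on
   ordered chains shows that contiguous simplicial maps agree on homology. *)
theory Submission
  imports Defs
begin

section \<open>Quotients of function spaces\<close>

text \<open>The composition law depends on \<open>acts_as_composite\<close>: the three edges alone
  give \<open>\<phi>h = (\<phi>g0)g1\<close> at one vertex, which controls sublevel sets only.
  Distances are maxima over all measurements, so distance 0 between the two maps needs this equation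
  at every vertex. On the homology side, carriers consist of cosets of functions, and all statements
  are reduced to representatives. Operators on chains are linear extensions of operators on lists,
  and a list is a cone over its tail. Thus \<partial>\<partial> = 0, naturality and the homotopy
  formula become list inductions built on \<partial>(x c) = c - x \<partial>c. For this rule to hold
  at a single vertex, the empty list must count as a face, so the recursion produces the augmented
  boundary. It differs from \<open>boundary\<close> in degree 0, which is therefore treated
  separately. Vertex maps and prisms may create repeated vertices; ordered chains keep such lists,
  so no degenerate terms have to be discarded.\<close>

definition linear_subspace :: "('a \<Rightarrow> 'k::field) set \<Rightarrow> bool" where
  "linear_subspace Z \<longleftrightarrow> (\<lambda>_. 0) \<in> Z \<and> (\<forall>u\<in>Z. \<forall>v\<in>Z. (\<lambda>x. u x + v x) \<in> Z) \<and>
     (\<forall>a. \<forall>u\<in>Z. (\<lambda>x. a * u x) \<in> Z)"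

lemma linear_subspaceI:
  assumes "(\<lambda>_. 0) \<in> Z" "\<And>u v. u \<in> Z \<Longrightarrow> v \<in> Z \<Longrightarrow> (\<lambda>x. u x + v x) \<in> Z"
    "\<And>a u. u \<in> Z \<Longrightarrow> (\<lambda>x. a * u x) \<in> Z"
  shows "linear_subspace Z"
  unfolding linear_subspace_def by (intro conjI ballI allI assms)

lemma linear_subspaceD:
  assumes "linear_subspace Z"
  shows "(\<lambda>_. 0) \<in> Z" "\<lbrakk>u \<in> Z; v \<in> Z\<rbrakk> \<Longrightarrow> (\<lambda>x. u x + v x) \<in> Z" "u \<in> Z \<Longrightarrow> (\<lambda>x. a * u x) \<in> Z"
    "u \<in> Z \<Longrightarrow> (\<lambda>x. - u x) \<in> Z" "\<lbrakk>u \<in> Z; v \<in> Z\<rbrakk> \<Longrightarrow> (\<lambda>x. u x - v x) \<in> Z"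
proof -
  show add: "(\<lambda>x. u x + v x) \<in> Z" if "u \<in> Z" "v \<in> Z" for u v
    using assms that by (simp add: linear_subspace_def)
  show scale: "(\<lambda>x. a * u x) \<in> Z" if "u \<in> Z" for a u
    using assms that by (simp add: linear_subspace_def)
  show neg: "(\<lambda>x. - u x) \<in> Z" if "u \<in> Z" for u
    using scale[OF that, of "-1"] by simp
  show "(\<lambda>x. u x - v x) \<in> Z" if "u \<in> Z" "v \<in> Z" for u v
    using add[OF that(1) neg[OF that(2)]] by simp
qed (use assms in \<open>simp add: linear_subspace_def\<close>)

lemma function_space_simps [simp]:
  "carrier (function_space Z) = Z" "\<zero>\<^bsub>function_space Z\<^esub> = (\<lambda>_. 0)"
  "u \<oplus>\<^bsub>function_space Z\<^esub> v = (\<lambda>x. u x + v x)" "a \<odot>\<^bsub>function_space Z\<^esub> u = (\<lambda>x. a * u x)"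
  by (simp_all add: function_space_def)

lemma vectorspace_function_space:
  fixes Z :: "('a \<Rightarrow> 'k::field) set"
  assumes "linear_subspace Z"
  shows "vectorspace class_ring (function_space Z)"
proof (rule vs_criteria[OF class_field])
  have "\<exists>w\<in>Z. (\<lambda>x. v x + w x) = (\<lambda>_. 0)" if "v \<in> Z" for v
    by (rule bexI[OF _ linear_subspaceD(4)[OF assms that]]) simp
  then show "\<forall>v\<in>carrier (function_space Z). \<exists>w\<in>carrier (function_space Z).
      v \<oplus>\<^bsub>function_space Z\<^esub> w = \<zero>\<^bsub>function_space Z\<^esub>"
    by simp
qed (use linear_subspaceD[OF assms] in \<open>auto simp: algebra_simps\<close>)

text \<open>The summand from \<open>B\<close> stands on the left as in the right cosets of
  \<open>quotient_space\<close>, so that both carriers agree by unfolding.\<close>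

definition coset_of :: "('a \<Rightarrow> 'k::field) set \<Rightarrow> ('a \<Rightarrow> 'k) \<Rightarrow> ('a \<Rightarrow> 'k) set" where
  "coset_of B v = (\<lambda>b x. b x + v x) ` B"

lemma coset_of_eq_iff:
  assumes "linear_subspace B"
  shows "coset_of B u = coset_of B v \<longleftrightarrow> (\<lambda>x. u x - v x) \<in> B"
proof
  assume eq: "coset_of B u = coset_of B v"
  have "u \<in> coset_of B u"
    using linear_subspaceD(1)[OF assms] by (force simp: coset_of_def)
  then obtain b where "b \<in> B" "u = (\<lambda>x. b x + v x)"
    unfolding eq by (auto simp: coset_of_def)
  then show "(\<lambda>x. u x - v x) \<in> B"
    by simp
next
  have sub: "coset_of B u \<subseteq> coset_of B v" if "(\<lambda>x. u x - v x) \<in> B" for u v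
  proof
    fix w assume "w \<in> coset_of B u"
    then obtain b where b: "b \<in> B" "w = (\<lambda>x. b x + u x)"
      by (auto simp: coset_of_def)
    have "(\<lambda>x. b x + (u x - v x)) \<in> B"
      by (rule linear_subspaceD(2)[OF assms b(1) that])
    then show "w \<in> coset_of B v"
      by (auto simp: coset_of_def b(2) image_iff fun_eq_iff intro!: bexI[rotated])
  qed
  assume uv: "(\<lambda>x. u x - v x) \<in> B"
  have "(\<lambda>x. v x - u x) \<in> B"
    using linear_subspaceD(4)[OF assms uv] by simp
  with uv show "coset_of B u = coset_of B v"
    by (simp add: sub subset_antisym)
qed

lemma coset_of_zero: "coset_of B (\<lambda>_. 0) = B"
  by (simp add: coset_of_def)

lemma set_add_function_space: "S <+>\<^bsub>function_space Z\<^esub> T = {\<lambda>x. u x + v x |u v. u \<in> S \<and> v \<in> T}"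
  by (auto simp: set_add_def set_mult_def function_space_def)

text \<open>Scalar multiplication in \<open>quotient_space\<close> and \<open>homology_map\<close>
  both have this shape. The image of a coset is a translate of the image of \<open>B\<close>, which
  may be too small (a single point for scaling by 0); adding \<open>B'\<close> fills it up to a full
  coset. Additivity is asked only along \<open>B + v\<close>, because \<open>chain_map\<close> is
  additive only on finitely supported functions.\<close>

lemma set_add_image_coset_of:
  assumes B: "linear_subspace B'" and img: "F ` B \<subseteq> B'" and zero: "(\<lambda>_. 0) \<in> B"
    and add: "\<And>b. b \<in> B \<Longrightarrow> F (\<lambda>x. b x + v x) = (\<lambda>x. F b x + F v x)"
  shows "B' <+>\<^bsub>function_space Z\<^esub> F ` coset_of B v = coset_of B' (F v)"
proof (intro subset_antisym subsetI)
  fix w assume "w \<in> B' <+>\<^bsub>function_space Z\<^esub> F ` coset_of B v"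
  then obtain b' b where b: "b' \<in> B'" "b \<in> B" and w: "w = (\<lambda>x. b' x + (F b x + F v x))"
    by (auto simp: set_add_function_space coset_of_def add)
  have "(\<lambda>x. b' x + F b x) \<in> B'"
    using b img by (intro linear_subspaceD(2)[OF B]) auto
  then show "w \<in> coset_of B' (F v)"
    unfolding coset_of_def by (rule rev_image_eqI) (simp add: w add.assoc)
next
  fix w assume "w \<in> coset_of B' (F v)"
  then obtain b' where b': "b' \<in> B'" "w = (\<lambda>x. b' x + F v x)"
    by (auto simp: coset_of_def)
  have "F v \<in> F ` coset_of B v"
    by (rule imageI) (use zero in \<open>force simp: coset_of_def\<close>)
  with b' show "w \<in> B' <+>\<^bsub>function_space Z\<^esub> F ` coset_of B v"
    by (auto simp: set_add_function_space)
qed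

lemma carrier_quotient_function_space:
  "carrier (quotient_space (function_space Z) B) = coset_of B ` Z"
  by (auto simp: quotient_space_def A_RCOSETS_def RCOSETS_def r_coset_def coset_of_def
      function_space_def image_def)

lemma zero_quotient_function_space: "\<zero>\<^bsub>quotient_space (function_space Z) B\<^esub> = coset_of B (\<lambda>_. 0)"
  by (simp add: quotient_space_def coset_of_zero)

lemma add_quotient_function_space:
  assumes B: "linear_subspace B"
  shows "coset_of B u \<oplus>\<^bsub>quotient_space (function_space Z) B\<^esub> coset_of B v = coset_of B (\<lambda>x. u x + v x)"
proof -
  have "coset_of B u <+>\<^bsub>function_space Z\<^esub> coset_of B v = coset_of B (\<lambda>x. u x + v x)"
  proof (intro subset_antisym subsetI)
    fix w assume "w \<in> coset_of B u <+>\<^bsub>function_space Z\<^esub> coset_of B v"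
    then obtain b c where bc: "b \<in> B" "c \<in> B" and w: "w = (\<lambda>x. (b x + u x) + (c x + v x))"
      by (auto simp: set_add_function_space coset_of_def)
    have "(\<lambda>x. b x + c x) \<in> B"
      by (rule linear_subspaceD(2)[OF B bc])
    then show "w \<in> coset_of B (\<lambda>x. u x + v x)"
      unfolding coset_of_def by (rule rev_image_eqI) (simp add: w algebra_simps)
  next
    fix w assume "w \<in> coset_of B (\<lambda>x. u x + v x)"
    then obtain b where b: "b \<in> B" and w: "w = (\<lambda>x. (b x + u x) + v x)"
      by (auto simp: coset_of_def add.assoc)
    have "(\<lambda>x. b x + u x) \<in> coset_of B u" "v \<in> coset_of B v"
      using b linear_subspaceD(1)[OF B] by (force simp: coset_of_def)+
    then show "w \<in> coset_of B u <+>\<^bsub>function_space Z\<^esub> coset_of B v"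
      unfolding set_add_function_space w mem_Collect_eq by (intro exI conjI) auto
  qed
  then show ?thesis
    by (simp add: quotient_space_def)
qed

lemma smult_quotient_function_space:
  assumes B: "linear_subspace B"
  shows "a \<odot>\<^bsub>quotient_space (function_space Z) B\<^esub> coset_of B v = coset_of B (\<lambda>x. a * v x)"
  using linear_subspaceD[OF B]
  by (simp add: quotient_space_def, intro set_add_image_coset_of)
    (auto simp: B algebra_simps)

lemma vectorspace_quotient_function_space:
  fixes Z :: "('a \<Rightarrow> 'k::field) set"
  assumes Z: "linear_subspace Z" and B: "linear_subspace B"
  shows "vectorspace class_ring (quotient_space (function_space Z) B)" (is "vectorspace _ ?Q")
proof (rule vs_criteria[OF class_field])
  note ops = carrier_quotient_function_space zero_quotient_function_space
    add_quotient_function_space[OF B] smult_quotient_function_space[OF B]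
  note mem = linear_subspaceD[OF Z]
  have "\<exists>w\<in>Z. coset_of B (\<lambda>x. v x + w x) = coset_of B (\<lambda>_. 0)" if "v \<in> Z" for v
    by (rule bexI[OF _ mem(4)[OF that]]) simp
  then show "\<forall>v\<in>carrier ?Q. \<exists>w\<in>carrier ?Q. v \<oplus>\<^bsub>?Q\<^esub> w = \<zero>\<^bsub>?Q\<^esub>"
    by (simp add: ops)
  show "\<zero>\<^bsub>?Q\<^esub> \<in> carrier ?Q"
    by (simp add: ops mem)
  show "\<forall>v w. v \<in> carrier ?Q \<and> w \<in> carrier ?Q \<longrightarrow> v \<oplus>\<^bsub>?Q\<^esub> w \<in> carrier ?Q"
    "\<forall>c v. c \<in> carrier class_ring \<and> v \<in> carrier ?Q \<longrightarrow> c \<odot>\<^bsub>?Q\<^esub> v \<in> carrier ?Q"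
    using mem by (auto simp: ops)
  show "\<forall>v w. v \<in> carrier ?Q \<and> w \<in> carrier ?Q \<longrightarrow> v \<oplus>\<^bsub>?Q\<^esub> w = w \<oplus>\<^bsub>?Q\<^esub> v"
    "\<forall>v w x. v \<in> carrier ?Q \<and> w \<in> carrier ?Q \<and> x \<in> carrier ?Q \<longrightarrow>
       v \<oplus>\<^bsub>?Q\<^esub> w \<oplus>\<^bsub>?Q\<^esub> x = v \<oplus>\<^bsub>?Q\<^esub> (w \<oplus>\<^bsub>?Q\<^esub> x)"
    "\<forall>v\<in>carrier ?Q. v \<oplus>\<^bsub>?Q\<^esub> \<zero>\<^bsub>?Q\<^esub> = v"
    "\<forall>v\<in>carrier ?Q. \<one>\<^bsub>class_ring\<^esub> \<odot>\<^bsub>?Q\<^esub> v = v"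
    by (auto simp: ops ac_simps)
  show "\<forall>a b v. a \<in> carrier class_ring \<and> b \<in> carrier class_ring \<and> v \<in> carrier ?Q \<longrightarrow>
      (a \<otimes>\<^bsub>class_ring\<^esub> b) \<odot>\<^bsub>?Q\<^esub> v = a \<odot>\<^bsub>?Q\<^esub> (b \<odot>\<^bsub>?Q\<^esub> v)"
    "\<forall>a b v. a \<in> carrier class_ring \<and> b \<in> carrier class_ring \<and> v \<in> carrier ?Q \<longrightarrow>
      (a \<oplus>\<^bsub>class_ring\<^esub> b) \<odot>\<^bsub>?Q\<^esub> v = a \<odot>\<^bsub>?Q\<^esub> v \<oplus>\<^bsub>?Q\<^esub> b \<odot>\<^bsub>?Q\<^esub> v"
    "\<forall>a v w. a \<in> carrier class_ring \<and> v \<in> carrier ?Q \<and> w \<in> carrier ?Q \<longrightarrow>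
      a \<odot>\<^bsub>?Q\<^esub> (v \<oplus>\<^bsub>?Q\<^esub> w) = a \<odot>\<^bsub>?Q\<^esub> v \<oplus>\<^bsub>?Q\<^esub> a \<odot>\<^bsub>?Q\<^esub> w"
    by (auto simp: ops distrib_left distrib_right mult.assoc)
qed

text \<open>Gaussian elimination, one coordinate \<open>s\<close> at a time: the functions in
  \<open>Z\<close> that vanish at \<open>s\<close> live on the smaller set, and at most one further
  generator is needed to correct the value at \<open>s\<close>. Since \<open>Z\<close> shrinks along
  the way, it is generalized in the induction.\<close>

lemma finitely_generated_function_space:
  fixes Z :: "('a \<Rightarrow> 'k::field) set"
  assumes "finite S" "linear_subspace Z" "\<And>z x. z \<in> Z \<Longrightarrow> x \<notin> S \<Longrightarrow> z x = 0"
  shows "\<exists>G. finite G \<and> G \<subseteq> Z \<and> (\<forall>z\<in>Z. \<exists>a. z = (\<lambda>x. \<Sum>g\<in>G. a g * g x))"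
  using assms
proof (induction S arbitrary: Z rule: finite_induct)
  case empty
  then show ?case
    by (intro exI[of _ "{}"]) auto
next
  case (insert s S)
  define Z' where "Z' = {z \<in> Z. z s = 0}"
  note mem = linear_subspaceD[OF insert.prems(1)]
  have "\<exists>G. finite G \<and> G \<subseteq> Z' \<and> (\<forall>z\<in>Z'. \<exists>a. z = (\<lambda>x. \<Sum>g\<in>G. a g * g x))"
  proof (rule insert.IH)
    show "linear_subspace Z'"
      using mem by (auto simp: linear_subspace_def Z'_def)
    show "z x = 0" if "z \<in> Z'" "x \<notin> S" for z x
      using insert.prems(2)[of z x] that by (cases "x = s") (auto simp: Z'_def)
  qed
  then obtain G where
    G': "finite G \<and> G \<subseteq> Z' \<and> (\<forall>z\<in>Z'. \<exists>a. z = (\<lambda>x. \<Sum>g\<in>G. a g * g x))" ..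
  then have G: "finite G" "G \<subseteq> Z'"
    by simp_all
  show ?case
  proof (cases "\<forall>z\<in>Z. z s = 0")
    case True
    then have "Z' = Z"
      by (auto simp: Z'_def)
    with G' show ?thesis
      by (intro exI[of _ G]) simp
  next
    case False
    then obtain z0 where z0: "z0 \<in> Z" "z0 s \<noteq> 0"
      by blast
    \<comment> \<open>All members of \<open>G\<close> vanish at \<open>s\<close>. Hence
      \<open>z0\<close> is a new generator, and its coefficient can be set without disturbing those
      on \<open>G\<close>.\<close>
    then have "z0 \<notin> G"
      using G(2) by (auto simp: Z'_def)
    have "\<exists>a. z = (\<lambda>x. \<Sum>g\<in>insert z0 G. a g * g x)" if "z \<in> Z" for z
    proof -
      \<comment> \<open>The multiple of \<open>z0\<close> that cancels the value of \<open>z\<close>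
        at \<open>s\<close>.\<close>
      define k where "k = z s / z0 s"
      have "z s - k * z0 s = 0"
        using z0(2) by (simp add: k_def)
      with mem(5)[OF that mem(3)[OF z0(1)], of k] have "(\<lambda>x. z x - k * z0 x) \<in> Z'"
        by (simp add: Z'_def)
      with G' obtain a where a: "(\<lambda>x. z x - k * z0 x) = (\<lambda>x. \<Sum>g\<in>G. a g * g x)"
        by (elim conjE bexE ballE exE) auto
      have "z x = (\<Sum>g\<in>insert z0 G. (a(z0 := k)) g * g x)" for x
      proof -
        have "(\<Sum>g\<in>insert z0 G. (a(z0 := k)) g * g x) = k * z0 x + (\<Sum>g\<in>G. a g * g x)"
          using G(1) \<open>z0 \<notin> G\<close> by (simp, intro sum.cong) auto
        also have "\<dots> = z x"
          using fun_cong[OF a, of x] by (simp add: algebra_simps)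
        finally show ?thesis ..
      qed
      then show ?thesis
        by (intro exI ext)
    qed
    with G(1,2) z0(1) show ?thesis
      by (intro exI[of _ "insert z0 G"]) (auto simp: Z'_def)
  qed
qed

text \<open>Bridge between the abstract \<open>finsum\<close> inside \<open>lincomb\<close> and the
  pointwise sums in which generators were found.\<close>

lemma finsum_function_space:
  fixes Z :: "('a \<Rightarrow> 'k::field) set"
  assumes Z: "linear_subspace Z" and "finite A" "f \<in> A \<rightarrow> Z"
  shows "finsum (function_space Z) f A = (\<lambda>x. \<Sum>i\<in>A. f i x)"
proof -
  interpret V: vectorspace class_ring "function_space Z"
    by (rule vectorspace_function_space[OF Z])
  show ?thesis
    using assms(2,3) by (induction A rule: finite_induct) (auto simp: V.M.finsum_insert Pi_def)
qed

lemma fin_dim_function_space: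
  fixes Z :: "('a \<Rightarrow> 'k::field) set"
  assumes Z: "linear_subspace Z" and S: "finite S" "\<And>z x. z \<in> Z \<Longrightarrow> x \<notin> S \<Longrightarrow> z x = 0"
  shows "vectorspace.fin_dim class_ring (function_space Z)"
proof -
  interpret V: vectorspace class_ring "function_space Z"
    by (rule vectorspace_function_space[OF Z])
  have "\<exists>G. finite G \<and> G \<subseteq> Z \<and> (\<forall>z\<in>Z. \<exists>a. z = (\<lambda>x. \<Sum>g\<in>G. a g * g x))"
    by (rule finitely_generated_function_space[OF S(1) Z]) (rule S(2))
  then obtain G where
    G': "finite G \<and> G \<subseteq> Z \<and> (\<forall>z\<in>Z. \<exists>a. z = (\<lambda>x. \<Sum>g\<in>G. a g * g x))" ..
  then have G: "finite G" "G \<subseteq> Z"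
    by simp_all
  have "z \<in> V.span G" if z: "z \<in> Z" for z
  proof -
    obtain a where a: "z = (\<lambda>x. \<Sum>g\<in>G. a g * g x)"
      using G' z by (elim conjE ballE exE) auto
    have "(\<lambda>v x. a v * v x) \<in> G \<rightarrow> Z"
      using G(2) linear_subspaceD(3)[OF Z] by auto
    from finsum_function_space[OF Z G(1) this] have "V.lincomb a G = z"
      by (simp add: V.lincomb_def a)
    then show ?thesis
      using G(1) by (auto simp: V.span_def)
  qed
  then have "V.span G = Z"
    using V.span_is_subset2[of G] G(2) by auto
  with G(1,2) show ?thesis
    unfolding V.fin_dim_def by (intro exI[of _ G]) simp
qed

text \<open>The projection \<open>coset_of B\<close> is linear and onto, and finite dimension passes
  to the image of a linear map.\<close>

lemma fin_dim_quotient_function_space: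
  fixes Z :: "('a \<Rightarrow> 'k::field) set"
  assumes Z: "linear_subspace Z" and B: "linear_subspace B"
    and S: "finite S" "\<And>z x. z \<in> Z \<Longrightarrow> x \<notin> S \<Longrightarrow> z x = 0"
  shows "vectorspace.fin_dim class_ring (quotient_space (function_space Z) B)" (is "vectorspace.fin_dim _ ?Q")
proof -
  interpret V: vectorspace class_ring "function_space Z"
    by (rule vectorspace_function_space[OF Z])
  interpret W: vectorspace class_ring ?Q
    by (rule vectorspace_quotient_function_space[OF Z B])
  have "coset_of B \<in> LinearCombinations.module_hom class_ring (function_space Z) ?Q"
    by (simp add: LinearCombinations.module_hom_def carrier_quotient_function_space add_quotient_function_space[OF B]
        smult_quotient_function_space[OF B])
  then interpret linear_map class_ring "function_space Z" ?Q "coset_of B"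
    by unfold_locales
  show ?thesis
  proof (rule surj_fin_dim)
    show "vectorspace.fin_dim class_ring (function_space Z)"
      by (rule fin_dim_function_space[OF Z S(1)]) (rule S(2))
  qed (simp add: carrier_quotient_function_space)
qed

section \<open>The ordered chain complex\<close>

text \<open>Junk unless \<open>c\<close> has finite support: infinite sums are \<open>0\<close>.\<close>

definition lin_ext :: "('x \<Rightarrow> 'y \<Rightarrow> 'k::field) \<Rightarrow> ('x \<Rightarrow> 'k) \<Rightarrow> 'y \<Rightarrow> 'k" where
  "lin_ext F c = (\<lambda>u. \<Sum>w | c w \<noteq> 0. c w * F w u)"

definition single :: "'x \<Rightarrow> 'x \<Rightarrow> 'k::field" where
  "single w = (\<lambda>u. if u = w then 1 else 0)"

definition finsupp :: "('x \<Rightarrow> 'k::field) \<Rightarrow> bool" where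
  "finsupp c \<longleftrightarrow> finite {w. c w \<noteq> 0}"

text \<open>Identities between several chains need one common summation range, while
  \<open>lin_ext\<close> sums over the support of its own argument.\<close>

lemma lin_ext_superset:
  assumes "finite S" "{w. c w \<noteq> 0} \<subseteq> S"
  shows "lin_ext F c u = (\<Sum>w\<in>S. c w * F w u)"
  unfolding lin_ext_def by (rule sum.mono_neutral_left) (use assms in auto)

lemma finsupp_zero [simp]: "finsupp (\<lambda>_. 0)"
  by (simp add: finsupp_def)

lemma finsupp_single [simp]: "finsupp (single w)"
  by (simp add: finsupp_def single_def)

lemma finsupp_add [simp]: "finsupp c \<Longrightarrow> finsupp d \<Longrightarrow> finsupp (\<lambda>u. c u + d u)"
  unfolding finsupp_def by (rule finite_subset[of _ "{w. c w \<noteq> 0} \<union> {w. d w \<noteq> 0}"]) auto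

lemma finsupp_diff [simp]: "finsupp c \<Longrightarrow> finsupp d \<Longrightarrow> finsupp (\<lambda>u. c u - d u)"
  unfolding finsupp_def by (rule finite_subset[of _ "{w. c w \<noteq> 0} \<union> {w. d w \<noteq> 0}"]) auto

lemma finsupp_scale [simp]: "finsupp c \<Longrightarrow> finsupp (\<lambda>u. a * c u)"
  unfolding finsupp_def by (rule finite_subset[of _ "{w. c w \<noteq> 0}"]) auto

lemma lin_ext_support:
  assumes "lin_ext F c u \<noteq> 0"
  obtains w where "c w \<noteq> 0" "F w u \<noteq> 0"
proof -
  have "\<exists>w\<in>{w. c w \<noteq> 0}. c w * F w u \<noteq> 0"
    using assms sum.neutral[of "{w. c w \<noteq> 0}" "\<lambda>w. c w * F w u"] unfolding lin_ext_def by blast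
  with that show ?thesis
    by auto
qed

lemma finsupp_lin_ext [simp]:
  assumes "finsupp c" "\<And>w. finsupp (F w)"
  shows "finsupp (lin_ext F c)"
  unfolding finsupp_def
proof (rule finite_subset)
  show "{u. lin_ext F c u \<noteq> 0} \<subseteq> (\<Union>w\<in>{w. c w \<noteq> 0}. {u. F w u \<noteq> 0})"
    by (auto elim: lin_ext_support)
  show "finite (\<Union>w\<in>{w. c w \<noteq> 0}. {u. F w u \<noteq> 0})"
    using assms by (auto simp: finsupp_def)
qed

lemma lin_ext_zero [simp]: "lin_ext F (\<lambda>_. 0) = (\<lambda>_. 0)"
  by (simp add: lin_ext_def)

lemma lin_ext_zero_left [simp]: "lin_ext (\<lambda>_ _. 0) c = (\<lambda>_. 0)"
  by (simp add: lin_ext_def)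

lemma lin_ext_single [simp]: "lin_ext F (single w) = F w"
  by (rule ext) (simp add: lin_ext_superset[of "{w}"] single_def)

lemma lin_ext_add:
  assumes "finsupp c" "finsupp d"
  shows "lin_ext F (\<lambda>u. c u + d u) = (\<lambda>u. lin_ext F c u + lin_ext F d u)"
proof
  fix u
  let ?S = "{w. c w \<noteq> 0} \<union> {w. d w \<noteq> 0}"
  have fin: "finite ?S"
    using assms by (simp add: finsupp_def)
  have "lin_ext F (\<lambda>u. c u + d u) u = (\<Sum>w\<in>?S. (c w + d w) * F w u)"
    by (rule lin_ext_superset[OF fin]) auto
  moreover have "lin_ext F c u = (\<Sum>w\<in>?S. c w * F w u)" "lin_ext F d u = (\<Sum>w\<in>?S. d w * F w u)"
    by (rule lin_ext_superset[OF fin]; auto)+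
  ultimately show "lin_ext F (\<lambda>u. c u + d u) u = lin_ext F c u + lin_ext F d u"
    by (simp add: distrib_right sum.distrib)
qed

lemma lin_ext_scale: "lin_ext F (\<lambda>u. a * c u) = (\<lambda>u. a * lin_ext F c u)"
  \<comment> \<open>Scaling by a nonzero \<open>a\<close> keeps the support, and with it the
    summation range; for \<open>a = 0\<close> the range becomes empty.\<close>
  by (cases "a = 0") (simp_all add: lin_ext_def sum_distrib_left mult.assoc)

lemma lin_ext_diff:
  assumes "finsupp c" "finsupp d"
  shows "lin_ext F (\<lambda>u. c u - d u) = (\<lambda>u. lin_ext F c u - lin_ext F d u)"
proof -
  have "finsupp (\<lambda>u. - 1 * d u)"
    using assms(2) by (simp add: finsupp_def)
  from lin_ext_add[OF assms(1) this] show ?thesis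
    unfolding lin_ext_scale by simp
qed

lemma lin_ext_diff_left: "lin_ext (\<lambda>w u. F w u - G w u) c = (\<lambda>u. lin_ext F c u - lin_ext G c u)"
  by (simp add: lin_ext_def right_diff_distrib sum_subtractf)

lemma lin_ext_add_left: "lin_ext (\<lambda>w u. F w u + G w u) c = (\<lambda>u. lin_ext F c u + lin_ext G c u)"
  by (simp add: lin_ext_def distrib_left sum.distrib)

lemma lin_ext_cong: "(\<And>w. c w \<noteq> 0 \<Longrightarrow> F w = G w) \<Longrightarrow> lin_ext F c = lin_ext G c"
  by (simp add: lin_ext_def)

text \<open>Interchange of two finite sums. This turns an identity between composed chain operators
  into one between their values on single lists.\<close>

lemma lin_ext_comp:
  assumes c: "finsupp c" and F: "\<And>w. finsupp (F w)"
  shows "lin_ext G (lin_ext F c) = lin_ext (\<lambda>w. lin_ext G (F w)) c"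
proof
  fix u
  let ?C = "{w. c w \<noteq> 0}"
  let ?S = "\<Union>w\<in>?C. {v. F w v \<noteq> 0}"
  have fin: "finite ?S"
    using c F by (auto simp: finsupp_def)
  have "lin_ext G (lin_ext F c) u = (\<Sum>v\<in>?S. lin_ext F c v * G v u)"
    by (rule lin_ext_superset[OF fin]) (auto elim: lin_ext_support)
  also have "\<dots> = (\<Sum>v\<in>?S. \<Sum>w\<in>?C. c w * (F w v * G v u))"
    by (simp add: lin_ext_def sum_distrib_right mult.assoc)
  also have "\<dots> = (\<Sum>w\<in>?C. c w * (\<Sum>v\<in>?S. F w v * G v u))"
    by (subst sum.swap) (simp add: sum_distrib_left)
  also have "\<dots> = (\<Sum>w\<in>?C. c w * lin_ext G (F w) u)"
    by (intro sum.cong refl arg_cong2[where f = "(*)"] lin_ext_superset[OF fin, symmetric]) auto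
  finally show "lin_ext G (lin_ext F c) u = lin_ext (\<lambda>w. lin_ext G (F w)) c u"
    by (simp add: lin_ext_def)
qed

lemma lin_ext_ident: "finsupp c \<Longrightarrow> lin_ext single c = c"
proof
  fix u assume "finsupp c"
  then have "lin_ext single c u = (\<Sum>w\<in>insert u {w. c w \<noteq> 0}. c w * single w u)"
    by (intro lin_ext_superset) (auto simp: finsupp_def)
  also have "\<dots> = (\<Sum>w\<in>insert u {w. c w \<noteq> 0}. if w = u then c w else 0)"
    by (intro sum.cong) (auto simp: single_def)
  also have "\<dots> = c u"
    using \<open>finsupp c\<close> by (subst sum.delta) (auto simp: finsupp_def)
  finally show "lin_ext single c u = c u" .
qed

text \<open>The linear extension of \<open>w \<mapsto> x # w\<close>, in a closed form that involves
  no sum.\<close>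

definition cone :: "'x \<Rightarrow> ('x list \<Rightarrow> 'k::field) \<Rightarrow> 'x list \<Rightarrow> 'k" where
  "cone x c = (\<lambda>u. case u of [] \<Rightarrow> 0 | y # v \<Rightarrow> if y = x then c v else 0)"

lemma cone_single: "cone x (single w) = single (x # w)"
  by (auto simp: cone_def single_def fun_eq_iff split: list.split)

lemma cone_zero [simp]: "cone x (\<lambda>_. 0) = (\<lambda>_. 0)"
  by (auto simp: cone_def fun_eq_iff split: list.split)

lemma cone_diff: "cone x (\<lambda>u. c u - d u) = (\<lambda>u. cone x c u - cone x d u)"
  by (auto simp: cone_def fun_eq_iff split: list.split)

lemma support_cone: "{u. cone x c u \<noteq> 0} = (#) x ` {v. c v \<noteq> 0}"
proof -
  have "cone x c u \<noteq> 0 \<longleftrightarrow> u \<in> (#) x ` {v. c v \<noteq> 0}" for u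
    by (cases u) (auto simp: cone_def)
  then show ?thesis
    by blast
qed

lemma finsupp_cone [simp]: "finsupp c \<Longrightarrow> finsupp (cone x c)"
  by (simp add: finsupp_def support_cone)

text \<open>With \<open>cone_lin_ext\<close>, this moves a cone through a linear extension, the
  basic manipulation in the list inductions below.\<close>

lemma lin_ext_cone: "lin_ext F (cone x c) = lin_ext (\<lambda>w. F (x # w)) c"
  unfolding lin_ext_def support_cone by (simp add: sum.reindex cone_def)

lemma cone_lin_ext: "cone x (lin_ext F c) = lin_ext (\<lambda>w. cone x (F w)) c"
  by (auto simp: cone_def lin_ext_def fun_eq_iff split: list.split)

text \<open>The augmented boundary of a list: \<open>[x]\<close> is sent to the empty list. The recursion presents a
  simplex as the cone with apex its first vertex, so that identities follow by induction.\<close>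

primrec list_boundary :: "'x list \<Rightarrow> 'x list \<Rightarrow> 'k::field" where
  "list_boundary [] = (\<lambda>_. 0)"
| "list_boundary (x # w) = (\<lambda>u. single w u - cone x (list_boundary w) u)"

lemma finsupp_list_boundary [simp]: "finsupp (list_boundary w)"
  by (induction w) simp_all

text \<open>Link to the alternating sum in \<open>boundary\<close>: face 0 of \<open>x # w\<close>
  is \<open>w\<close>, and face \<open>i + 1\<close> is the cone over face \<open>i\<close> of
  \<open>w\<close>, with the sign flipped by the index shift.\<close>

lemma list_boundary_eq_faces:
  "list_boundary w u = (\<Sum>i<length w. if face i w = u then (-1) ^ i else 0 :: 'k::field)"
proof (induction w arbitrary: u)
  case (Cons x w)
  have "cone x (list_boundary w) u = (\<Sum>i<length w. if x # face i w = u then (-1) ^ i else 0 :: 'k)"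
    by (cases u) (auto simp: cone_def Cons.IH intro!: sum.cong)
  then show ?case
    by (simp add: sum.lessThan_Suc_shift face_def single_def eq_commute[of w] sum_negf[symmetric]
        if_distrib[of uminus] del: sum.lessThan_Suc cong: if_cong)
qed simp

lemma list_boundary_support:
  "list_boundary w u \<noteq> 0 \<Longrightarrow> length w = Suc (length u) \<and> set u \<subseteq> set w"
  by (induction w arbitrary: u)
    (fastforce simp: cone_def single_def split: list.splits if_splits)+

text \<open>From \<partial>(x c) = c - x \<partial>c and the induction hypothesis, \<partial>(x
  \<partial>w) = \<partial>w. This cancels against the boundary of the first face
  \<open>w\<close>.\<close>

lemma lin_ext_list_boundary_list_boundary:
  "lin_ext list_boundary (list_boundary w) = (\<lambda>_. 0 :: 'k::field)"
proof (induction w)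
  case (Cons x w)
  have "lin_ext list_boundary (cone x (list_boundary w)) = (list_boundary w :: _ \<Rightarrow> 'k)"
    by (simp add: lin_ext_cone lin_ext_diff_left cone_lin_ext[symmetric] Cons lin_ext_ident)
  then show ?case
    by (simp add: lin_ext_diff)
qed simp

text \<open>Coning with apex \<open>x\<close> becomes coning with apex \<open>f x\<close>. Lists
  with repeated entries are legitimate, so vertices identified by \<open>f\<close> need no special
  case.\<close>

lemma lin_ext_list_boundary_single_map:
  "lin_ext (\<lambda>v. single (map f v)) (list_boundary w) = (list_boundary (map f w) :: _ \<Rightarrow> 'k::field)"
proof (induction w)
  case (Cons x w)
  have "lin_ext (\<lambda>v. single (map f v)) (cone x (list_boundary w)) =
      (cone (f x) (lin_ext (\<lambda>v. single (map f v)) (list_boundary w)) :: _ \<Rightarrow> 'k)"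
    by (simp add: lin_ext_cone cone_lin_ext cone_single)
  then show ?case
    by (simp add: lin_ext_diff Cons)
qed simp

text \<open>The prism operator \<open>[v\<^sub>0, \<dots>, v\<^sub>n] \<mapsto> \<Sum>i. (-1)^i [f v\<^sub>0, \<dots>, f v\<^sub>i, g v\<^sub>i, \<dots>, g v\<^sub>n]\<close>.\<close>

primrec prism :: "('x \<Rightarrow> 'x) \<Rightarrow> ('x \<Rightarrow> 'x) \<Rightarrow> 'x list \<Rightarrow> 'x list \<Rightarrow> 'k::field" where
  "prism f g [] = (\<lambda>_. 0)"
| "prism f g (x # w) = (\<lambda>u. single (f x # g x # map g w) u - cone (f x) (prism f g w) u)"

lemma finsupp_prism [simp]: "finsupp (prism f g w)"
  by (induction w) simp_all

lemma prism_support: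
  "prism f g w u \<noteq> 0 \<Longrightarrow> length u = Suc (length w) \<and> set u \<subseteq> f ` set w \<union> g ` set w"
  by (induction w arbitrary: u)
    (fastforce simp: cone_def single_def split: list.splits if_splits)+

text \<open>The formula \<partial>P + P\<partial> = g - f on a single list. For \<open>x # w\<close>
  the two copies of P(w) cancel, as do the terms with apexes \<open>f x\<close> and
  \<open>g x\<close> over \<partial>(g w); the rest is the induction hypothesis coned from
  \<open>f x\<close>.\<close>

lemma prism_homotopy:
  "lin_ext list_boundary (prism f g w) u + lin_ext (prism f g) (list_boundary w) u =
     (single (map g w) u - single (map f w) u :: 'k::field)"
proof (induction w arbitrary: u)
  case (Cons x w)
  let ?b = "list_boundary :: _ \<Rightarrow> _ \<Rightarrow> 'k" and ?p = "prism f g :: _ \<Rightarrow> _ \<Rightarrow> 'k"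
  have IH: "cone (f x) (lin_ext ?b (?p w)) u + cone (f x) (lin_ext ?p (?b w)) u =
      single (f x # map g w) u - single (f x # map f w) u"
    using Cons.IH by (cases u) (auto simp: cone_def single_def)
  have "lin_ext ?b (cone (f x) (?p w)) u = ?p w u - cone (f x) (lin_ext ?b (?p w)) u"
    by (simp add: lin_ext_cone lin_ext_diff_left cone_lin_ext[symmetric] lin_ext_ident)
  then have 1: "lin_ext ?b (?p (x # w)) u = single (g x # map g w) u
      - cone (f x) (?b (g x # map g w)) u - ?p w u + cone (f x) (lin_ext ?b (?p w)) u"
    by (simp add: lin_ext_diff)
  \<comment> \<open>The leading terms of the prisms over the faces of \<open>w\<close> involve
    \<open>g\<close> applied to these faces; by naturality they add up to the boundary of
    \<open>map g w\<close>.\<close>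
  have "lin_ext ?p (cone x (?b w)) u = cone (f x) (cone (g x) (?b (map g w))) u
      - cone (f x) (lin_ext ?p (?b w)) u"
    by (simp add: lin_ext_cone lin_ext_diff_left cone_lin_ext[symmetric] cone_single[symmetric]
        lin_ext_list_boundary_single_map)
  then have 2: "lin_ext ?p (?b (x # w)) u = ?p w u
      - cone (f x) (cone (g x) (?b (map g w))) u + cone (f x) (lin_ext ?p (?b w)) u"
    by (simp add: lin_ext_diff)
  have 3: "cone (f x) (?b (g x # map g w)) u =
      single (f x # map g w) u - cone (f x) (cone (g x) (?b (map g w))) u"
    by (simp add: cone_diff cone_single)
  show ?case
    unfolding 1 2 3 using IH by (simp add: algebra_simps)
qed simp

section \<open>Functoriality and homotopy invariance of homology\<close>

definition simplicial_complex :: "'x set set \<Rightarrow> bool" where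
  "simplicial_complex K \<longleftrightarrow> {} \<notin> K \<and> (\<forall>\<sigma>\<in>K. \<forall>\<tau>. \<tau> \<subseteq> \<sigma> \<longrightarrow> \<tau> \<noteq> {} \<longrightarrow> \<tau> \<in> K)"

lemma simplicial_complexD:
  "\<lbrakk>simplicial_complex K; \<sigma> \<in> K; \<tau> \<subseteq> \<sigma>; \<tau> \<noteq> {}\<rbrakk> \<Longrightarrow> \<tau> \<in> K"
  by (simp add: simplicial_complex_def)

definition simplicial_map :: "'x set set \<Rightarrow> 'x set set \<Rightarrow> ('x \<Rightarrow> 'x) \<Rightarrow> bool" where
  "simplicial_map K L f \<longleftrightarrow> (\<forall>\<sigma>\<in>K. f ` \<sigma> \<in> L)"

lemma chainsI:
  "finsupp c \<Longrightarrow> (\<And>w. c w \<noteq> 0 \<Longrightarrow> length w = Suc n \<and> set w \<in> K) \<Longrightarrow> c \<in> chains K n"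
  by (simp add: chains_def finsupp_def)

lemma chainsD:
  assumes "c \<in> chains K n"
  shows "finsupp c" "c w \<noteq> 0 \<Longrightarrow> length w = Suc n" "c w \<noteq> 0 \<Longrightarrow> set w \<in> K"
  using assms by (auto simp: chains_def finsupp_def)

lemma finsupp_cycles: "c \<in> cycles K n \<Longrightarrow> finsupp c"
  by (simp add: cycles_def chains_def finsupp_def)

text \<open>Positive degrees only: in degree 0 \<open>boundary\<close> is zero, whereas
  \<open>list_boundary\<close> sends a vertex to the empty list.\<close>

lemma boundary_eq_lin_ext:
  assumes "c \<in> chains K (Suc n)"
  shows "boundary (Suc n) c = lin_ext list_boundary c"
proof
  fix u
  have "(\<Sum>i\<le>Suc n. if face i w = u then (-1) ^ i * c w else 0) = c w * list_boundary w u"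
    if "c w \<noteq> 0" for w
  proof -
    have "{..Suc n} = {..<length w}"
      using chainsD(2)[OF assms that] by auto
    then show ?thesis
      unfolding list_boundary_eq_faces sum_distrib_left by (intro sum.cong) auto
  qed
  then show "boundary (Suc n) c u = lin_ext list_boundary c u"
    unfolding boundary_def lin_ext_def if_not_P[OF nat.distinct(2)]
    by (intro sum.cong refl) simp_all
qed

lemma chain_map_eq_lin_ext:
  assumes "finsupp c"
  shows "chain_map f c = lin_ext (\<lambda>w. single (map f w)) c"
proof
  fix u
  have "chain_map f c u = (\<Sum>w\<in>{w. c w \<noteq> 0} \<inter> {w. map f w = u}. c w)"
    by (simp add: chain_map_def Collect_conj_eq)
  also have "\<dots> = (\<Sum>w | c w \<noteq> 0. if map f w = u then c w else 0)"
    using assms by (subst sum.inter_restrict) (simp_all add: finsupp_def)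
  also have "\<dots> = lin_ext (\<lambda>w. single (map f w)) c u"
    unfolding lin_ext_def by (intro sum.cong refl) (auto simp: single_def)
  finally show "chain_map f c u = lin_ext (\<lambda>w. single (map f w)) c u" .
qed

lemma chain_map_add:
  assumes "finsupp c" "finsupp d"
  shows "chain_map f (\<lambda>u. c u + d u) = (\<lambda>u. chain_map f c u + chain_map f d u)"
  using assms by (simp add: chain_map_eq_lin_ext lin_ext_add)

lemma chain_map_scale:
  assumes "finsupp c"
  shows "chain_map f (\<lambda>u. a * c u) = (\<lambda>u. a * chain_map f c u)"
  using assms by (simp add: chain_map_eq_lin_ext lin_ext_scale)

lemma chain_map_in_chains:
  assumes "simplicial_map K L f" "c \<in> chains K n"
  shows "chain_map f c \<in> chains L n"
proof (rule chainsI)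
  note c = chainsD[OF assms(2)]
  show "finsupp (chain_map f c)"
    using c(1) by (simp add: chain_map_eq_lin_ext)
  fix u assume "chain_map f c u \<noteq> 0"
  then have "lin_ext (\<lambda>w. single (map f w)) c u \<noteq> 0"
    by (simp add: chain_map_eq_lin_ext[OF c(1)])
  then obtain w where "c w \<noteq> 0" "u = map f w"
    by (rule lin_ext_support) (simp add: single_def split: if_splits)
  then show "length u = Suc n \<and> set u \<in> L"
    using c(2,3)[of w] assms(1) by (simp add: simplicial_map_def)
qed

lemma boundary_in_chains:
  assumes K: "simplicial_complex K" and c: "c \<in> chains K (Suc n)"
  shows "boundary (Suc n) c \<in> chains K n"
proof (rule chainsI)
  note c' = chainsD[OF c]
  show "finsupp (boundary (Suc n) c)"
    using c'(1) by (simp add: boundary_eq_lin_ext[OF c])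
  fix u assume "boundary (Suc n) c u \<noteq> 0"
  then have "lin_ext list_boundary c u \<noteq> 0"
    by (simp add: boundary_eq_lin_ext[OF c])
  then obtain w where w: "c w \<noteq> 0" "list_boundary w u \<noteq> (0 :: 'b)"
    by (rule lin_ext_support)
  then have "length u = Suc n" "set u \<subseteq> set w" "set w \<in> K"
    using list_boundary_support[OF w(2)] c'(2,3)[OF w(1)] by auto
  \<comment> \<open>Positive degree keeps faces nonempty, as the closure property of a complex
    requires.\<close>
  moreover from \<open>length u = Suc n\<close> have "set u \<noteq> {}"
    by auto
  ultimately show "length u = Suc n \<and> set u \<in> K"
    using simplicial_complexD[OF K] by simp
qed

lemma boundary_boundary:
  assumes K: "simplicial_complex K" and c: "c \<in> chains K (Suc n)"
  shows "boundary n (boundary (Suc n) c) = (\<lambda>_. 0)"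
proof (cases n)
  case (Suc m)
  have "boundary (Suc n) c \<in> chains K (Suc m)"
    using boundary_in_chains[OF K c] Suc by simp
  from boundary_eq_lin_ext[OF this]
  have "boundary n (boundary (Suc n) c) = lin_ext list_boundary (lin_ext list_boundary c)"
    by (simp only: Suc boundary_eq_lin_ext[OF c, unfolded Suc])
  then show ?thesis
    by (simp add: lin_ext_comp[OF chainsD(1)[OF c]] lin_ext_list_boundary_list_boundary)
qed (simp add: boundary_def)

lemma boundary_chain_map:
  assumes K: "simplicial_complex K" and f: "simplicial_map K L f" and c: "c \<in> chains K n"
  shows "boundary n (chain_map f c) = chain_map f (boundary n c)"
proof (cases n)
  case 0
  then show ?thesis
    by (simp add: boundary_def chain_map_eq_lin_ext)
next
  case (Suc m)
  note fin = chainsD(1)[OF c]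
  have c': "c \<in> chains K (Suc m)"
    using c Suc by simp
  have "boundary n (chain_map f c) = lin_ext list_boundary (lin_ext (\<lambda>w. single (map f w)) c)"
    using boundary_eq_lin_ext[OF chain_map_in_chains[OF f c']]
    by (simp only: Suc chain_map_eq_lin_ext[OF fin])
  also have "\<dots> = lin_ext (\<lambda>w. list_boundary (map f w)) c"
    by (simp add: lin_ext_comp[OF fin])
  also have "\<dots> = lin_ext (\<lambda>w. single (map f w)) (lin_ext list_boundary c)"
    by (simp add: lin_ext_comp[OF fin] lin_ext_list_boundary_single_map)
  also have "\<dots> = chain_map f (boundary n c)"
    using fin by (simp add: Suc boundary_eq_lin_ext[OF c'] chain_map_eq_lin_ext)
  finally show ?thesis .
qed

section \<open>Linear structure of chains, cycles and boundaries, and its behaviour under chain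
  maps\<close>

lemma linear_subspace_chains: "linear_subspace (chains K n :: ('x list \<Rightarrow> 'k::field) set)"
proof (rule linear_subspaceI)
  show "(\<lambda>_. 0) \<in> chains K n"
    by (simp add: chains_def)
next
  fix u v :: "'x list \<Rightarrow> 'k" assume u: "u \<in> chains K n" and v: "v \<in> chains K n"
  show "(\<lambda>w. u w + v w) \<in> chains K n"
  proof (rule chainsI)
    show "finsupp (\<lambda>w. u w + v w)"
      by (rule finsupp_add[OF chainsD(1)[OF u] chainsD(1)[OF v]])
    show "length w = Suc n \<and> set w \<in> K" if "u w + v w \<noteq> 0" for w
    proof (cases "u w = 0")
      case True
      with that have "v w \<noteq> 0"
        by simp
      with chainsD(2,3)[OF v] show ?thesis
        by simp
    qed (simp add: chainsD(2,3)[OF u])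
  qed
next
  fix a and u :: "'x list \<Rightarrow> 'k" assume u: "u \<in> chains K n"
  show "(\<lambda>w. a * u w) \<in> chains K n"
  proof (rule chainsI)
    show "finsupp (\<lambda>w. a * u w)"
      by (rule finsupp_scale[OF chainsD(1)[OF u]])
    show "length w = Suc n \<and> set w \<in> K" if "a * u w \<noteq> 0" for w
      using that chainsD(2,3)[OF u, of w] by simp
  qed
qed

lemma boundary_add:
  assumes "c \<in> chains K n" "d \<in> chains K n"
  shows "boundary n (\<lambda>w. c w + d w) = (\<lambda>w. boundary n c w + boundary n d w)"
proof (cases n)
  case (Suc m)
  show ?thesis
    using boundary_eq_lin_ext[OF assms(1)[unfolded Suc]] boundary_eq_lin_ext[OF assms(2)[unfolded Suc]]
      boundary_eq_lin_ext[OF linear_subspaceD(2)[OF linear_subspace_chains assms, unfolded Suc]]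
    by (simp add: Suc lin_ext_add[OF chainsD(1)[OF assms(1)] chainsD(1)[OF assms(2)]])
qed (simp add: boundary_def)

lemma boundary_scale:
  assumes "c \<in> chains K n"
  shows "boundary n (\<lambda>w. a * c w) = (\<lambda>w. a * boundary n c w)"
proof (cases n)
  case (Suc m)
  show ?thesis
    using boundary_eq_lin_ext[OF assms[unfolded Suc]]
      boundary_eq_lin_ext[OF linear_subspaceD(3)[OF linear_subspace_chains assms, unfolded Suc]]
    by (simp add: Suc lin_ext_scale)
qed (simp add: boundary_def)

lemma linear_subspace_cycles: "linear_subspace (cycles K n :: ('x list \<Rightarrow> 'k::field) set)"
proof (rule linear_subspaceI)
  note mem = linear_subspaceD[OF linear_subspace_chains[of K n]]
  show "(\<lambda>_. 0) \<in> cycles K n"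
    by (simp add: cycles_def boundary_def chains_def)
  show "(\<lambda>w. u w + v w) \<in> cycles K n" if "u \<in> cycles K n" "v \<in> cycles K n" for u v :: "'x list \<Rightarrow> 'k"
    using that mem(2)[of u v] boundary_add[of u K n v] by (simp add: cycles_def)
  show "(\<lambda>w. a * u w) \<in> cycles K n" if "u \<in> cycles K n" for a and u :: "'x list \<Rightarrow> 'k"
    using that mem(3)[of u a] boundary_scale[of u K n a] by (simp add: cycles_def)
qed

lemma linear_subspace_boundaries: "linear_subspace (boundaries K n :: ('x list \<Rightarrow> 'k::field) set)"
proof (rule linear_subspaceI)
  note mem = linear_subspaceD[OF linear_subspace_chains[of K "Suc n"]]
  have "boundary (Suc n) (\<lambda>_. 0) = (\<lambda>_. 0)"
    by (simp add: boundary_def)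
  then show "(\<lambda>_. 0) \<in> boundaries K n"
    unfolding boundaries_def using mem(1) by (intro image_eqI[OF sym])
next
  note mem = linear_subspaceD[OF linear_subspace_chains[of K "Suc n"]]
  fix u v :: "'x list \<Rightarrow> 'k" assume "u \<in> boundaries K n" "v \<in> boundaries K n"
  then obtain c d where cd: "c \<in> chains K (Suc n)" "d \<in> chains K (Suc n)"
    and uv: "u = boundary (Suc n) c" "v = boundary (Suc n) d"
    unfolding boundaries_def by (elim imageE)
  show "(\<lambda>w. u w + v w) \<in> boundaries K n"
    unfolding boundaries_def uv using boundary_add[OF cd, symmetric] mem(2)[OF cd] by (rule image_eqI)
next
  note mem = linear_subspaceD[OF linear_subspace_chains[of K "Suc n"]]
  fix a and u :: "'x list \<Rightarrow> 'k" assume "u \<in> boundaries K n"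
  then obtain c where c: "c \<in> chains K (Suc n)" and u: "u = boundary (Suc n) c"
    unfolding boundaries_def by (elim imageE)
  show "(\<lambda>w. a * u w) \<in> boundaries K n"
    unfolding boundaries_def u using boundary_scale[OF c, symmetric] mem(3)[OF c] by (rule image_eqI)
qed

lemma boundaries_subset_cycles:
  assumes "simplicial_complex K"
  shows "boundaries K n \<subseteq> cycles K n"
  using boundary_in_chains[OF assms] boundary_boundary[OF assms]
  by (auto simp: boundaries_def cycles_def)

lemma chain_map_in_cycles:
  assumes "simplicial_complex K" "simplicial_map K L f" "c \<in> cycles K n"
  shows "chain_map f c \<in> cycles L n"
proof -
  have c: "c \<in> chains K n" "boundary n c = (\<lambda>_. 0)"
    using assms(3) by (simp_all add: cycles_def)
  have "boundary n (chain_map f c) = (\<lambda>_. 0)"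
    unfolding boundary_chain_map[OF assms(1,2) c(1)] c(2) by (simp add: chain_map_def)
  with chain_map_in_chains[OF assms(2) c(1)] show ?thesis
    by (simp add: cycles_def)
qed

lemma chain_map_boundaries:
  assumes "simplicial_complex K" "simplicial_map K L f"
  shows "chain_map f ` boundaries K n \<subseteq> boundaries L n"
proof -
  have "chain_map f (boundary (Suc n) c) \<in> boundaries L n" if "c \<in> chains K (Suc n)" for c
    unfolding boundaries_def
    using boundary_chain_map[OF assms that, symmetric] chain_map_in_chains[OF assms(2) that]
    by (rule image_eqI)
  then show ?thesis
    by (auto simp: boundaries_def)
qed

lemma chain_map_ident: "finsupp c \<Longrightarrow> chain_map (\<lambda>x. x) c = c"
  by (simp add: chain_map_eq_lin_ext lin_ext_ident)

lemma chain_map_compose: "finsupp c \<Longrightarrow> chain_map g (chain_map f c) = chain_map (\<lambda>x. g (f x)) c"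
  by (simp add: chain_map_eq_lin_ext lin_ext_comp comp_def)

text \<open>Each list in the prism over \<open>w\<close> has its vertices in the union of the two
  images of \<open>set w\<close>; contiguity makes this union a simplex of \<open>L\<close>.\<close>

lemma lin_ext_prism_in_chains:
  assumes "\<And>\<sigma>. \<sigma> \<in> K \<Longrightarrow> f ` \<sigma> \<union> g ` \<sigma> \<in> L" and L: "simplicial_complex L" and c: "c \<in> chains K n"
  shows "lin_ext (prism f g) c \<in> chains L (Suc n)"
proof (rule chainsI)
  note c' = chainsD[OF c]
  show "finsupp (lin_ext (prism f g) c)"
    using c'(1) by simp
  fix u assume "lin_ext (prism f g) c u \<noteq> 0"
  then obtain w where w: "c w \<noteq> 0" "prism f g w u \<noteq> (0 :: 'b)"
    by (rule lin_ext_support)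
  then have "length u = Suc (Suc n)" "set u \<subseteq> f ` set w \<union> g ` set w" "f ` set w \<union> g ` set w \<in> L"
    using prism_support[OF w(2)] c'(2)[OF w(1)] assms(1)[OF c'(3)[OF w(1)]] by auto
  moreover from \<open>length u = Suc (Suc n)\<close> have "set u \<noteq> {}"
    by auto
  ultimately show "length u = Suc (Suc n) \<and> set u \<in> L"
    using simplicial_complexD[OF L] by simp
qed

text \<open>The prism over \<open>c\<close> is the bounding chain, once the term P\<partial>c of the
  homotopy formula is gone. In positive degree it vanishes because \<open>c\<close> is a cycle. In
  degree 0 being a cycle says nothing about the augmentation of \<open>c\<close>, so another reason
  is required there.\<close>

lemma contiguous_chain_maps_homologous:
  assumes contig: "\<And>\<sigma>. \<sigma> \<in> K \<Longrightarrow> f ` \<sigma> \<union> g ` \<sigma> \<in> L" and L: "simplicial_complex L"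
    and c: "c \<in> cycles K n"
  shows "(\<lambda>u. chain_map g c u - chain_map f c u) \<in> boundaries L n"
proof -
  have ch: "c \<in> chains K n" and cyc: "boundary n c = (\<lambda>_. 0)"
    using c by (auto simp: cycles_def)
  note fin = chainsD(1)[OF ch]
  note P = lin_ext_prism_in_chains[OF contig L ch]
  have zero: "lin_ext (prism f g) (lin_ext list_boundary c) = (\<lambda>_. 0)"
  proof (cases n)
    case 0
    \<comment> \<open>The augmentation of \<open>c\<close> is a multiple of the empty list, which has no prism.\<close>
    have "lin_ext (prism f g) (list_boundary w) = (\<lambda>_. 0 :: 'b)" if "c w \<noteq> 0" for w
    proof -
      obtain x where "w = [x]"
        using chainsD(2)[OF ch \<open>c w \<noteq> 0\<close>] by (auto simp: 0 length_Suc_conv)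
      then show ?thesis
        by simp
    qed
    then have "lin_ext (\<lambda>w. lin_ext (prism f g) (list_boundary w)) c = lin_ext (\<lambda>_ _. 0) c"
      by (rule lin_ext_cong)
    then show ?thesis
      by (simp add: lin_ext_comp[OF fin])
  next
    case (Suc m)
    then show ?thesis
      using cyc boundary_eq_lin_ext[OF ch[unfolded Suc]] by simp
  qed
  have "boundary (Suc n) (lin_ext (prism f g) c) = (\<lambda>u. chain_map g c u - chain_map f c u)"
  proof
    fix u
    have "boundary (Suc n) (lin_ext (prism f g) c) u =
        lin_ext (\<lambda>w u. lin_ext list_boundary (prism f g w) u + lin_ext (prism f g) (list_boundary w) u) c u"
      using zero by (simp add: boundary_eq_lin_ext[OF P] lin_ext_comp[OF fin] lin_ext_add_left)
    also have "\<dots> = chain_map g c u - chain_map f c u"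
      by (simp add: prism_homotopy lin_ext_diff_left chain_map_eq_lin_ext[OF fin])
    finally show "boundary (Suc n) (lin_ext (prism f g) c) u = chain_map g c u - chain_map f c u" .
  qed
  then show ?thesis
    unfolding boundaries_def using P by (intro image_eqI[OF sym])
qed

section \<open>Homology spaces and induced maps\<close>

lemma carrier_homology: "carrier (homology d K) = coset_of (boundaries K d) ` cycles K d"
  by (simp add: homology_def carrier_quotient_function_space)

lemma vectorspace_homology: "vectorspace class_ring (homology d K)"
  unfolding homology_def
  by (rule vectorspace_quotient_function_space[OF linear_subspace_cycles linear_subspace_boundaries])

text \<open>All cycles are supported on the finitely many lists of length \<open>Suc d\<close> over
  \<open>X\<close>.\<close>

lemma fin_dim_homology:
  assumes "finite X" "\<And>\<sigma>. \<sigma> \<in> K \<Longrightarrow> \<sigma> \<subseteq> X"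
  shows "vectorspace.fin_dim class_ring (homology d K)"
  unfolding homology_def
proof (rule fin_dim_quotient_function_space[OF linear_subspace_cycles linear_subspace_boundaries])
  show "finite {w. set w \<subseteq> X \<and> length w = Suc d}"
    by (rule finite_lists_length_eq[OF assms(1)])
  show "z w = 0" if "z \<in> cycles K d" "w \<notin> {w. set w \<subseteq> X \<and> length w = Suc d}" for z w
    using that chainsD(2,3)[of z K d w] assms(2) by (auto simp: cycles_def)
qed

text \<open>Replaces the set-level definition of \<open>homology_map\<close> by its value on
  representatives; linearity, functoriality and homotopy invariance all go through this
  form.\<close>

lemma homology_map_coset:
  assumes K: "simplicial_complex K" and f: "simplicial_map K L f" and z: "z \<in> cycles K d"
  shows "homology_map d K L f (coset_of (boundaries K d) z) = coset_of (boundaries L d) (chain_map f z)"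
proof -
  have "boundaries L d <+>\<^bsub>function_space (cycles L d)\<^esub> chain_map f ` coset_of (boundaries K d) z =
      coset_of (boundaries L d) (chain_map f z)"
  proof (rule set_add_image_coset_of)
    show "chain_map f (\<lambda>x. b x + z x) = (\<lambda>x. chain_map f b x + chain_map f z x)"
      if "b \<in> boundaries K d" for b
      using that z boundaries_subset_cycles[OF K] by (intro chain_map_add finsupp_cycles[of _ K d]) auto
  qed (use linear_subspaceD(1)[OF linear_subspace_boundaries] in
      \<open>auto intro: linear_subspace_boundaries chain_map_boundaries[OF K f, THEN subsetD]\<close>)
  then show ?thesis
    using z by (simp add: homology_map_def carrier_homology)
qed

lemma homology_map_extensional: "homology_map d K L f \<in> extensional (carrier (homology d K))"
  by (simp add: homology_map_def)

lemma homology_map_in_Hom: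
  assumes K: "simplicial_complex K" and f: "simplicial_map K L f"
  shows "homology_map d K L f \<in> Hom Vect (homology d K) (homology d L)"
proof -
  note ops = add_quotient_function_space[OF linear_subspace_boundaries]
    smult_quotient_function_space[OF linear_subspace_boundaries]
  note mem = linear_subspaceD[OF linear_subspace_cycles]
  have "homology_map d K L f \<in> LinearCombinations.module_hom class_ring (homology d K) (homology d L)"
    unfolding LinearCombinations.module_hom_def carrier_homology
    by (auto simp: homology_map_coset[OF K f] chain_map_in_cycles[OF K f] homology_def ops mem
        chain_map_add chain_map_scale finsupp_cycles)
  then show ?thesis
    by (simp add: Vect_def homology_map_extensional)
qed

lemma homology_map_eqI:
  assumes "simplicial_complex K" "simplicial_map K L f" "h \<in> extensional (carrier (homology d K))"
    and "\<And>z. z \<in> cycles K d \<Longrightarrow>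
      h (coset_of (boundaries K d) z) = coset_of (boundaries L d) (chain_map f z)"
  shows "h = homology_map d K L f"
  by (rule extensionalityI[OF assms(3) homology_map_extensional])
    (auto simp: carrier_homology homology_map_coset[OF assms(1,2)] assms(4))

lemma homology_map_ident:
  assumes "simplicial_complex K"
  shows "homology_map d K K (\<lambda>x. x) = Id Vect (homology d K)"
proof (rule homology_map_eqI[symmetric, OF assms])
  show "Id Vect (homology d K) (coset_of (boundaries K d) z) =
      coset_of (boundaries K d) (chain_map (\<lambda>x. x) z)" if "z \<in> cycles K d" for z
    using that by (auto simp: Vect_def carrier_homology chain_map_ident chainsD(1) cycles_def)
qed (simp_all add: Vect_def simplicial_map_def)

lemma homology_map_compose:
  assumes K: "simplicial_complex K" and L: "simplicial_complex L"
    and f: "simplicial_map K L f" and g: "simplicial_map L N g"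
  shows "Cmp Vect (homology d K) (homology d L) (homology d N) (homology_map d L N g) (homology_map d K L f) =
    homology_map d K N (\<lambda>x. g (f x))"
proof (rule homology_map_eqI[OF K])
  show "simplicial_map K N (\<lambda>x. g (f x))"
    using f g by (auto simp: simplicial_map_def image_image[symmetric])
  show "Cmp Vect (homology d K) (homology d L) (homology d N) (homology_map d L N g)
      (homology_map d K L f) (coset_of (boundaries K d) z) =
      coset_of (boundaries N d) (chain_map (\<lambda>x. g (f x)) z)" if z: "z \<in> cycles K d" for z
  proof -
    show ?thesis
      using z by (simp add: finsupp_cycles[OF z] Vect_def compose_def carrier_homology homology_map_coset[OF K f]
          homology_map_coset[OF L g] chain_map_in_cycles[OF K f] chain_map_compose)
  qed
qed (simp add: Vect_def compose_def)

lemma homology_map_contiguous: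
  assumes K: "simplicial_complex K" and L: "simplicial_complex L"
    and f: "simplicial_map K L f" and g: "simplicial_map K L g"
    and contig: "\<And>\<sigma>. \<sigma> \<in> K \<Longrightarrow> f ` \<sigma> \<union> g ` \<sigma> \<in> L"
  shows "homology_map d K L g = homology_map d K L f"
proof (rule homology_map_eqI[OF K f homology_map_extensional])
  show "homology_map d K L g (coset_of (boundaries K d) z) = coset_of (boundaries L d) (chain_map f z)"
    if z: "z \<in> cycles K d" for z
    unfolding homology_map_coset[OF K g z] coset_of_eq_iff[OF linear_subspace_boundaries]
    by (rule contiguous_chain_maps_homologous[OF contig L z])
qed

section \<open>The categories of vector spaces and of tame functors\<close>

lemma category_Vect: "category (Vect :: (('k::field, 'v) module, 'v \<Rightarrow> 'v) precategory)"
proof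
  note defs = Vect_def LinearCombinations.module_hom_def
  fix a b c e :: "('k, 'v) module" and f g h :: "'v \<Rightarrow> 'v"
  show "Id Vect a \<in> Hom Vect a a" if "a \<in> Ob Vect"
  proof -
    interpret vectorspace class_ring a
      using that by (simp add: Vect_def)
    show ?thesis
      by (simp add: defs)
  qed
  show "Cmp Vect a b c g f \<in> Hom Vect a c"
    if "a \<in> Ob Vect" "b \<in> Ob Vect" "c \<in> Ob Vect" "f \<in> Hom Vect a b" "g \<in> Hom Vect b c"
  proof -
    interpret vectorspace class_ring a
      using that by (simp add: Vect_def)
    show ?thesis
      using that(4,5) by (simp add: defs compose_def Pi_def)
  qed
  assume f: "f \<in> Hom Vect a b"
  then have f': "f \<in> carrier a \<rightarrow> carrier b" "f \<in> extensional (carrier a)"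
    by (auto simp: defs)
  show "Cmp Vect a a b f (Id Vect a) = f"
    using f' by (simp add: Vect_def) (rule extensionalityI[of _ "carrier a"]; simp add: compose_def)
  show "Cmp Vect a b b (Id Vect b) f = f"
    using f' by (simp add: Vect_def Id_compose)
  show "Cmp Vect a c e h (Cmp Vect a b c g f) = Cmp Vect a b e (Cmp Vect b c e h g) f"
    using f' by (simp add: Vect_def compose_assoc)
qed

lemma (in category) is_iso_Id: "a \<in> Ob C \<Longrightarrow> is_iso C a a (Id C a)"
  unfolding is_iso_def using Id_in_Hom Cmp_Id by blast

text \<open>Tameness restricts objects and not morphisms, so the category axioms are proved for the
  full subcategory on an arbitrary set \<open>S\<close> of functors.\<close>

lemma (in category) category_par_functors:
  assumes "S \<subseteq> {P. par_functor C P}"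
  shows "category \<lparr>Ob = S, Hom = nat_trans C, Id = (\<lambda>P. \<lambda>p\<in>par. Id C (obj P p)),
    Cmp = (\<lambda>P Q R \<eta> \<theta>. \<lambda>p\<in>par. Cmp C (obj P p) (obj Q p) (obj R p) (\<eta> p) (\<theta> p))\<rparr>"
    (is "category ?D")
proof
  have ob: "obj P p \<in> Ob C" if "P \<in> S" "p \<in> par" for P p
    using assms that by (auto simp: par_functor_def)
  have tr: "tr P p q \<in> Hom C (obj P p) (obj P q)" if "P \<in> S" "p \<in> par" "q \<in> par" "par_le p q" for P p q
    using assms that by (auto simp: par_functor_def)
  have nt: "\<eta> p \<in> Hom C (obj P p) (obj Q p)" if "\<eta> \<in> nat_trans C P Q" "p \<in> par" for P Q \<eta> p
    using that by (auto simp: nat_trans_def)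
  have ext: "\<eta> \<in> extensional par" if "\<eta> \<in> nat_trans C P Q" for P Q \<eta>
    using that by (auto simp: nat_trans_def)
  have nat: "Cmp C (obj P p) (obj P q) (obj Q q) (\<eta> q) (tr P p q) =
      Cmp C (obj P p) (obj Q p) (obj Q q) (tr Q p q) (\<eta> p)"
    if "\<eta> \<in> nat_trans C P Q" "p \<in> par" "q \<in> par" "par_le p q" for P Q \<eta> p q
    using that by (auto simp: nat_trans_def)
  fix P Q R U \<eta> \<theta> \<zeta>
  show "Id ?D P \<in> Hom ?D P P" if "P \<in> Ob ?D"
    using that by (auto simp: nat_trans_def ob tr Id_in_Hom Cmp_Id Id_Cmp)
  show "Cmp ?D P Q R \<theta> \<eta> \<in> Hom ?D P R"
    if "P \<in> Ob ?D" "Q \<in> Ob ?D" "R \<in> Ob ?D" and \<eta>: "\<eta> \<in> Hom ?D P Q" and \<theta>: "\<theta> \<in> Hom ?D Q R"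
  proof -
    have S: "P \<in> S" "Q \<in> S" "R \<in> S" and \<eta>': "\<eta> \<in> nat_trans C P Q" and \<theta>': "\<theta> \<in> nat_trans C Q R"
      using that by simp_all
    have "Cmp C (obj P p) (obj P q) (obj R q) (Cmp C (obj P q) (obj Q q) (obj R q) (\<theta> q) (\<eta> q)) (tr P p q) =
        Cmp C (obj P p) (obj R p) (obj R q) (tr R p q) (Cmp C (obj P p) (obj Q p) (obj R p) (\<theta> p) (\<eta> p))"
      (is "?l = ?r") if pq: "p \<in> par" "q \<in> par" "par_le p q" for p q
    proof -
      \<comment> \<open>The naturality squares of \<open>\<eta>\<close> and \<open>\<theta>\<close>
        are pasted along \<open>tr Q p q\<close>, with a reassociation before and after
        each.\<close>
      have "?l = Cmp C (obj P p) (obj Q q) (obj R q) (\<theta> q) (Cmp C (obj P p) (obj P q) (obj Q q) (\<eta> q) (tr P p q))"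
        by (rule Cmp_assoc[symmetric]) (use S pq in \<open>auto intro: ob tr nt[OF \<eta>'] nt[OF \<theta>']\<close>)
      also have "\<dots> = Cmp C (obj P p) (obj Q q) (obj R q) (\<theta> q) (Cmp C (obj P p) (obj Q p) (obj Q q) (tr Q p q) (\<eta> p))"
        by (simp only: nat[OF \<eta>' pq])
      also have "\<dots> = Cmp C (obj P p) (obj Q p) (obj R q) (Cmp C (obj Q p) (obj Q q) (obj R q) (\<theta> q) (tr Q p q)) (\<eta> p)"
        by (rule Cmp_assoc) (use S pq in \<open>auto intro: ob tr nt[OF \<eta>'] nt[OF \<theta>']\<close>)
      also have "\<dots> = Cmp C (obj P p) (obj Q p) (obj R q) (Cmp C (obj Q p) (obj R p) (obj R q) (tr R p q) (\<theta> p)) (\<eta> p)"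
        by (simp only: nat[OF \<theta>' pq])
      also have "\<dots> = ?r"
        by (rule Cmp_assoc[symmetric]) (use S pq in \<open>auto intro: ob tr nt[OF \<eta>'] nt[OF \<theta>']\<close>)
      finally show ?thesis .
    qed
    then show ?thesis
      using S by (auto simp: nat_trans_def intro!: Cmp_in_Hom ob nt[OF \<eta>'] nt[OF \<theta>'])
  qed
  assume S: "P \<in> Ob ?D" "Q \<in> Ob ?D" and \<eta>: "\<eta> \<in> Hom ?D P Q"
  then have \<eta>': "\<eta> \<in> nat_trans C P Q"
    by simp
  show "Cmp ?D P P Q \<eta> (Id ?D P) = \<eta>" "Cmp ?D P Q Q (Id ?D Q) \<eta> = \<eta>"
    using S by (auto intro!: extensionalityI[OF _ ext[OF \<eta>']] simp: Cmp_Id Id_Cmp ob nt[OF \<eta>'])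
  assume "R \<in> Ob ?D" "U \<in> Ob ?D" "\<theta> \<in> Hom ?D Q R" "\<zeta> \<in> Hom ?D R U"
  then show "Cmp ?D P R U \<zeta> (Cmp ?D P Q R \<theta> \<eta>) = Cmp ?D P Q U (Cmp ?D Q R U \<zeta> \<theta>) \<eta>"
    using S by (auto intro!: restrict_ext Cmp_assoc ob nt[OF \<eta>'] nt)
qed

lemma category_Tame: "category Tame"
  unfolding Tame_def by (rule category.category_par_functors[OF category_Vect]) blast

section \<open>Tameness\<close>

lemma finite_set_strict_mono_enumeration:
  fixes A :: "'a::linorder set"
  assumes "finite A" "A \<noteq> {}"
  obtains m :: nat and r where "strict_mono_on {..m} r" "r ` {..m} = A"
proof
  \<comment> \<open>The index range \<open>{..m}\<close> has \<open>m + 1\<close> elements, hence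
    \<open>card A - 1\<close>; nonemptiness of \<open>A\<close> prevents the natural subtraction
    from truncating.\<close>
  let ?xs = "sorted_list_of_set A" and ?m = "card A - 1"
  have le: "i \<le> ?m \<longleftrightarrow> i < length ?xs" for i
    using assms card_gt_0_iff[of A] by auto
  show "strict_mono_on {..?m} (\<lambda>i. ?xs ! i)"
    unfolding strict_mono_on_def atMost_iff le
    by (auto intro: sorted_wrt_nth_less[OF strict_sorted_list_of_set])
  have "set ?xs = A"
    using assms(1) by simp
  then show "(\<lambda>i. ?xs ! i) ` {..?m} = A"
    unfolding atMost_def le by (auto simp: set_conv_nth)
qed

text \<open>No enumerated value lies strictly between \<open>r i\<close> and
  \<open>r (Suc i)\<close>, so a threshold \<open>a\<close> among these values cannot separate two
  points of the half-open gap. A threshold equal to \<open>r i\<close> lies below both.\<close>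

lemma strict_mono_on_gap:
  fixes r :: "nat \<Rightarrow> 'a::linorder"
  assumes r: "strict_mono_on {..m} r" and "i < m" and a: "a \<in> r ` {..m}"
    and "r i \<le> x" "x \<le> y" "y < r (Suc i)"
  shows "a \<le> x \<longleftrightarrow> a \<le> y"
proof
  assume "a \<le> y"
  obtain k where k: "k \<le> m" "a = r k"
    using a by auto
  have mono: "r j \<le> r l" if "j \<le> l" "l \<le> m" for j l
    using strict_mono_on_leD[OF r, of j l] that by simp
  have "k \<le> i"
  proof (rule ccontr)
    assume "\<not> k \<le> i"
    with k \<open>a \<le> y\<close> \<open>y < r (Suc i)\<close> mono[of "Suc i" k] show False
      by simp
  qed
  with mono[of k i] k \<open>i < m\<close> \<open>r i \<le> x\<close> show "a \<le> x"
    by simp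
qed (use \<open>x \<le> y\<close> in simp)

section \<open>Sublevel Vietoris-Rips complexes and their dependence on the parameters\<close>

lemma mem_sublevel_VR:
  "\<sigma> \<in> sublevel_VR X \<Phi> \<phi> p \<longleftrightarrow> \<sigma> \<noteq> {} \<and> finite \<sigma> \<and> \<sigma> \<subseteq> X \<and> (\<forall>x\<in>\<sigma>. \<phi> x \<le> snd p) \<and>
     (\<forall>x\<in>\<sigma>. \<forall>y\<in>\<sigma>. data_dist \<Phi> x y \<le> fst p)"
  by (auto simp: sublevel_VR_def vietoris_rips_def split: prod.split)

lemma simplicial_complex_sublevel_VR: "simplicial_complex (sublevel_VR X \<Phi> \<phi> p)"
  unfolding simplicial_complex_def
proof (intro conjI ballI allI impI)
  show "{} \<notin> sublevel_VR X \<Phi> \<phi> p"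
    by (simp add: mem_sublevel_VR)
  show "\<tau> \<in> sublevel_VR X \<Phi> \<phi> p" if "\<sigma> \<in> sublevel_VR X \<Phi> \<phi> p" "\<tau> \<subseteq> \<sigma>" "\<tau> \<noteq> {}" for \<sigma> \<tau>
    using that finite_subset[OF that(2)] by (simp add: mem_sublevel_VR subset_iff)
qed

lemma simplicial_map_sublevel_VR:
  assumes "par_le p q"
  shows "simplicial_map (sublevel_VR X \<Phi> \<phi> p) (sublevel_VR X \<Phi> \<phi> q) (\<lambda>x. x)"
proof -
  have "\<sigma> \<in> sublevel_VR X \<Phi> \<phi> q" if "\<sigma> \<in> sublevel_VR X \<Phi> \<phi> p" for \<sigma>
    using that assms unfolding mem_sublevel_VR par_le_def by (meson order_trans)
  then show ?thesis
    by (simp add: simplicial_map_def)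
qed

lemma sublevel_VR_cong:
  assumes "\<And>x. x \<in> X \<Longrightarrow> \<phi> x \<le> snd p \<longleftrightarrow> \<phi> x \<le> snd q"
    and "\<And>x y. x \<in> X \<Longrightarrow> y \<in> X \<Longrightarrow> data_dist \<Phi> x y \<le> fst p \<longleftrightarrow> data_dist \<Phi> x y \<le> fst q"
  shows "sublevel_VR X \<Phi> \<phi> p = sublevel_VR X \<Phi> \<phi> q"
proof -
  have "\<sigma> \<in> sublevel_VR X \<Phi> \<phi> p \<longleftrightarrow> \<sigma> \<in> sublevel_VR X \<Phi> \<phi> q" for \<sigma>
  proof (cases "\<sigma> \<subseteq> X")
    case True
    then have "\<phi> x \<le> snd p \<longleftrightarrow> \<phi> x \<le> snd q"
      "y \<in> \<sigma> \<Longrightarrow> data_dist \<Phi> x y \<le> fst p \<longleftrightarrow> data_dist \<Phi> x y \<le> fst q" if "x \<in> \<sigma>" for x y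
      using assms(1)[of x] assms(2)[of x y] that by (simp_all add: subset_iff)
    then show ?thesis
      unfolding mem_sublevel_VR by (simp cong: ball_cong)
  qed (simp add: mem_sublevel_VR)
  then show ?thesis
    by blast
qed

lemma homology_in_Ob_Vect: "homology d K \<in> Ob Vect"
  by (simp add: Vect_def vectorspace_homology)

lemma par_functor_PH: "par_functor Vect (PH d X \<Phi> \<phi>)"
  unfolding par_functor_def PH_def
  by (auto simp: homology_in_Ob_Vect homology_map_ident simplicial_complex_sublevel_VR
      homology_map_compose simplicial_map_sublevel_VR
      intro!: homology_map_in_Hom)

text \<open>Between equal complexes the transition map is induced by the identity on vertices, so it
  is the identity of one homology space.\<close>

lemma constant_on_PH:
  assumes "\<And>p q. \<lbrakk>p \<in> B; q \<in> B; par_le p q\<rbrakk> \<Longrightarrow> sublevel_VR X \<Phi> \<phi> p = sublevel_VR X \<Phi> \<phi> q"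
  shows "constant_on Vect (PH d X \<Phi> \<phi>) B"
  unfolding constant_on_def
proof (intro ballI impI)
  fix p q assume "p \<in> B" "q \<in> B" "par_le p q"
  then have "sublevel_VR X \<Phi> \<phi> q = sublevel_VR X \<Phi> \<phi> p"
    by (rule assms[symmetric])
  then show "is_iso Vect (obj (PH d X \<Phi> \<phi>) p) (obj (PH d X \<Phi> \<phi>) q) (tr (PH d X \<Phi> \<phi>) p q)"
    by (simp add: PH_def homology_map_ident[OF simplicial_complex_sublevel_VR]
        category.is_iso_Id[OF category_Vect homology_in_Ob_Vect])
qed

text \<open>The member \<open>\<phi>\<close> makes the set under \<open>Max\<close> nonempty, so the
  maximum is attained and bounds an absolute value from above.\<close>

lemma data_dist_nonneg:
  assumes "finite \<Phi>" "\<phi> \<in> \<Phi>"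
  shows "0 \<le> data_dist \<Phi> x y"
  unfolding data_dist_def using assms by (intro order_trans[OF abs_ge_zero Max_ge]) auto

lemma tame_PH:
  assumes X: "finite X" and \<Phi>: "finite \<Phi>" "\<phi> \<in> \<Phi>"
  shows "tame (PH d X \<Phi> \<phi> :: (('k::field, _) module, _) par_diagram)"
proof -
  let ?P = "PH d X \<Phi> \<phi> :: (('k, _) module, _) par_diagram"
  \<comment> \<open>Critical distances. As distances are nonnegative, adding 0 and \<infinity>
    forces the enumeration to start at 0 and to end at \<infinity>.\<close>
  define A where "A = {0, \<infinity>} \<union> (\<lambda>(x, y). ereal (data_dist \<Phi> x y)) ` (X \<times> X)"
  \<comment> \<open>Critical levels. The least element of \<open>B\<close> is the minimum of
    \<open>\<phi>\<close>, or \<infinity> if \<open>X\<close> is empty; in the latter case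
    \<open>l = 0\<close> and only the unbounded lower blocks remain.\<close>
  define B where "B = insert \<infinity> ((\<lambda>x. ereal (\<phi> x)) ` X)"
  have "finite A" "A \<noteq> {}" "finite B" "B \<noteq> {}"
    using X by (simp_all add: A_def B_def)
  obtain m :: nat and r where r: "strict_mono_on {..m} r" "r ` {..m} = A"
    using finite_set_strict_mono_enumeration[OF \<open>finite A\<close> \<open>A \<noteq> {}\<close>] .
  obtain l :: nat and s where s: "strict_mono_on {..l} s" "s ` {..l} = B"
    using finite_set_strict_mono_enumeration[OF \<open>finite B\<close> \<open>B \<noteq> {}\<close>] .
  have r_mono: "r i \<le> r j" if "i \<le> j" "j \<le> m" for i j
    using strict_mono_on_leD[OF r(1), of i j] that by simp
  have s_mono: "s i \<le> s j" if "i \<le> j" "j \<le> l" for i j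
    using strict_mono_on_leD[OF s(1), of i j] that by simp
  have "r 0 = 0"
  proof (rule antisym)
    have "0 \<in> r ` {..m}"
      by (simp add: r A_def)
    then obtain k where "k \<le> m" "r k = 0"
      by auto
    then show "r 0 \<le> 0"
      using r_mono[of 0 k] by simp
    have "r 0 \<in> A"
      using r(2) by blast
    then show "0 \<le> r 0"
      using data_dist_nonneg[OF \<Phi>] by (auto simp: A_def)
  qed
  have "r m = \<infinity>"
  proof -
    have "\<infinity> \<in> r ` {..m}"
      by (simp add: r A_def)
    then obtain k where "k \<le> m" "r k = \<infinity>"
      by (metis atMost_iff imageE)
    then show ?thesis
      using r_mono[of k m] by simp
  qed
  have "s l = \<infinity>"
  proof -
    have "\<infinity> \<in> s ` {..l}"
      by (simp add: s B_def)
    then obtain k where "k \<le> l" "s k = \<infinity>"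
      by (metis atMost_iff imageE)
    then show ?thesis
      using s_mono[of k l] by simp
  qed
  have "s 0 \<in> B"
    using s(2) by blast
  then have "s 0 \<noteq> -\<infinity>"
    by (auto simp: B_def)
  have dist: "data_dist \<Phi> x y \<le> fst p \<longleftrightarrow> data_dist \<Phi> x y \<le> fst q"
    if "i < m" "x \<in> X" "y \<in> X" "fst p \<le> fst q" "r i \<le> ereal (fst p)" "ereal (fst q) < r (Suc i)"
    for i x y and p q :: "real \<times> real"
  proof -
    have "ereal (data_dist \<Phi> x y) \<in> r ` {..m}"
      using that by (auto simp: r A_def)
    from strict_mono_on_gap[OF r(1) \<open>i < m\<close> this that(5) _ that(6)] that(4) show ?thesis
      by simp
  qed
  have level: "\<phi> x \<le> snd p \<longleftrightarrow> \<phi> x \<le> snd q"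
    if "j < l" "x \<in> X" "snd p \<le> snd q" "s j \<le> ereal (snd p)" "ereal (snd q) < s (Suc j)"
    for j x and p q :: "real \<times> real"
  proof -
    have "ereal (\<phi> x) \<in> s ` {..l}"
      using that by (auto simp: s B_def)
    from strict_mono_on_gap[OF s(1) \<open>j < l\<close> this that(4) _ that(5)] that(3) show ?thesis
      by simp
  qed
  \<comment> \<open>Below \<open>s 0\<close> every sublevel set is empty, which settles the blocks
    without a lower bound on the level.\<close>
  have below: "\<not> \<phi> x \<le> b" if "x \<in> X" "ereal b < s 0" for x b
  proof -
    have "ereal (\<phi> x) \<in> s ` {..l}"
      using that by (auto simp: s B_def)
    then obtain k where "k \<le> l" "ereal (\<phi> x) = s k"
      by auto
    then have "s 0 \<le> ereal (\<phi> x)"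
      using s_mono[of 0 k] by simp
    with that(2) have "ereal b < ereal (\<phi> x)"
      by (rule less_le_trans)
    then show ?thesis
      by simp
  qed
  have "constant_on Vect ?P (block (r i) (r (Suc i)) (-\<infinity>) (s 0))" if "i < m" for i
    using that
    by (intro constant_on_PH sublevel_VR_cong dist[of i]) (auto simp: block_def par_le_def below)
  moreover have "constant_on Vect ?P (block (r i) (r (Suc i)) (s j) (s (Suc j)))" if "i < m" "j < l" for i j
    using that
    by (intro constant_on_PH sublevel_VR_cong dist[of i] level[of j]) (auto simp: block_def par_le_def)
  moreover have "vectorspace.fin_dim class_ring (obj ?P p)" for p
    by (simp add: PH_def) (rule fin_dim_homology[OF X], simp add: mem_sublevel_VR)
  ultimately show ?thesis
    unfolding tame_def
    using r(1) s(1) \<open>r 0 = 0\<close> \<open>r m = \<infinity>\<close> \<open>s l = \<infinity>\<close> \<open>s 0 \<noteq> -\<infinity>\<close>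
    by (intro conjI ballI exI[of _ m] exI[of _ l] exI[of _ r] exI[of _ s] allI impI)
qed

section \<open>The action of the incarnation\<close>

lemma data_dist_eqI:
  assumes "\<And>\<psi>. \<psi> \<in> \<Phi> \<Longrightarrow> \<psi> x = \<psi> x'" "\<And>\<psi>. \<psi> \<in> \<Phi> \<Longrightarrow> \<psi> y = \<psi> y'"
  shows "data_dist \<Phi> x y = data_dist \<Phi> x' y'"
proof -
  have "\<bar>\<psi> x - \<psi> y\<bar> = \<bar>\<psi> x' - \<psi> y'\<bar>" if "\<psi> \<in> \<Phi>" for \<psi>
    using assms(1)[OF that] assms(2)[OF that] by (simp only:)
  then show ?thesis
    unfolding data_dist_def by (intro arg_cong[where f = Max] image_cong refl)
qed

text \<open>The term of \<open>\<psi>\<close> in the distance of \<open>g x\<close> and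
  \<open>g y\<close> is the term of the measurement \<open>\<psi>g\<close> in the distance of
  \<open>x\<close> and \<open>y\<close>, and \<open>\<psi>g\<close> again belongs to
  \<open>\<Phi>\<close>.\<close>

lemma data_dist_nonexpansive:
  assumes "finite \<Phi>" "\<phi> \<in> \<Phi>" "g \<in> data_endos X \<Phi>" "x \<in> X" "y \<in> X"
  shows "data_dist \<Phi> (g x) (g y) \<le> data_dist \<Phi> x y"
  unfolding data_dist_def
proof (rule Max.boundedI)
  fix a assume "a \<in> (\<lambda>\<psi>. \<bar>\<psi> (g x) - \<psi> (g y)\<bar>) ` \<Phi>"
  then obtain \<psi> where \<psi>: "\<psi> \<in> \<Phi>" and a: "a = \<bar>compose X \<psi> g x - compose X \<psi> g y\<bar>"
    using assms(4,5) by (auto simp: compose_def)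
  have "compose X \<psi> g \<in> \<Phi>"
    using assms(3) \<psi> by (simp add: data_endos_def)
  then show "a \<le> Max ((\<lambda>\<phi>. \<bar>\<phi> x - \<phi> y\<bar>) ` \<Phi>)"
    unfolding a using assms(1) by (intro Max_ge) auto
qed (use assms in auto)

lemma simplicial_map_action:
  assumes "finite \<Phi>" "\<phi> \<in> \<Phi>" "g \<in> data_endos X \<Phi>"
  shows "simplicial_map (sublevel_VR X \<Phi> (compose X \<phi> g) p) (sublevel_VR X \<Phi> \<phi> p) g"
  unfolding simplicial_map_def
proof
  fix \<sigma> assume \<sigma>: "\<sigma> \<in> sublevel_VR X \<Phi> (compose X \<phi> g) p"
  then have X: "\<sigma> \<subseteq> X"
    by (simp add: mem_sublevel_VR)
  have "g x \<in> X" if "x \<in> X" for x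
    using assms(3) that by (auto simp: data_endos_def)
  moreover have "data_dist \<Phi> (g x) (g y) \<le> fst p" if "x \<in> \<sigma>" "y \<in> \<sigma>" for x y
    using data_dist_nonexpansive[OF assms, of x y] \<sigma> X that unfolding mem_sublevel_VR
    by (meson order_trans subsetD)
  moreover have "\<phi> (g x) \<le> snd p" if "x \<in> \<sigma>" for x
  proof -
    have "compose X \<phi> g x \<le> snd p"
      using \<sigma> that by (simp add: mem_sublevel_VR)
    then show ?thesis
      using X that by (simp add: compose_def subset_iff)
  qed
  ultimately show "g ` \<sigma> \<in> sublevel_VR X \<Phi> \<phi> p"
    using \<sigma> X by (auto simp: mem_sublevel_VR)
qed

text \<open>Both ways around a naturality square are induced by the same vertex map
  \<open>g\<close>, the transition maps being identities on vertices.\<close>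

lemma PH_map_nat_trans:
  assumes "finite \<Phi>" "\<phi> \<in> \<Phi>" "g \<in> data_endos X \<Phi>"
  shows "PH_map d X \<Phi> g \<phi> \<in> nat_trans Vect (PH d X \<Phi> (compose X \<phi> g)) (PH d X \<Phi> \<phi>)"
  unfolding nat_trans_def PH_map_def PH_def
  by (auto simp: homology_map_compose simplicial_complex_sublevel_VR simplicial_map_sublevel_VR
      simplicial_map_action[OF assms] intro!: homology_map_in_Hom)

text \<open>The hypothesis \<open>comp\<close> serves twice: at \<open>\<phi>\<close> it keeps both
  images of a simplex in the same sublevel set, and over all of \<open>\<Phi>\<close> it keeps their
  union within the same diameter.\<close>

lemma PH_map_compose:
  fixes X :: "'x set"
  assumes \<Phi>: "finite \<Phi>" "\<phi> \<in> \<Phi>"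
    and g0: "g0 \<in> data_endos X \<Phi>" and g1: "g1 \<in> data_endos X \<Phi>" and h: "h \<in> data_endos X \<Phi>"
    and comp: "\<And>\<psi>. \<psi> \<in> \<Phi> \<Longrightarrow> compose X \<psi> h = compose X (compose X \<psi> g0) g1"
    and p: "p \<in> par"
  shows "(PH_map d X \<Phi> h \<phi> p :: ('x list \<Rightarrow> 'k::field) set \<Rightarrow> _) = Cmp Vect
    (obj (PH d X \<Phi> (compose X (compose X \<phi> g0) g1)) p) (obj (PH d X \<Phi> (compose X \<phi> g0)) p)
    (obj (PH d X \<Phi> \<phi>) p) (PH_map d X \<Phi> g0 \<phi> p) (PH_map d X \<Phi> g1 (compose X \<phi> g0) p)"
proof -
  define K where "K = sublevel_VR X \<Phi> (compose X (compose X \<phi> g0) g1) p"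
  define K' where "K' = sublevel_VR X \<Phi> (compose X \<phi> g0) p"
  define L where "L = sublevel_VR X \<Phi> \<phi> p"
  have \<phi>g0: "compose X \<phi> g0 \<in> \<Phi>"
    using g0 \<Phi>(2) by (simp add: data_endos_def)
  have closed: "g0 x \<in> X" "g1 x \<in> X" "h x \<in> X" if "x \<in> X" for x
    using g0 g1 h that by (auto simp: data_endos_def)
  have eq: "\<psi> (g0 (g1 x)) = \<psi> (h x)" if "\<psi> \<in> \<Phi>" "x \<in> X" for \<psi> x
    using fun_cong[OF comp[OF that(1)], of x] that(2) closed by (simp add: compose_def)
  have K: "simplicial_complex K" and K': "simplicial_complex K'" and L: "simplicial_complex L"
    by (simp_all add: K_def K'_def L_def simplicial_complex_sublevel_VR)
  have s1: "simplicial_map K K' g1" and s0: "simplicial_map K' L g0"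
    using simplicial_map_action[OF \<Phi>(1) \<phi>g0 g1] simplicial_map_action[OF \<Phi> g0]
    by (simp_all add: K_def K'_def L_def)
  have sh: "simplicial_map K L h"
    using simplicial_map_action[OF \<Phi> h] by (simp add: K_def L_def comp[OF \<Phi>(2)])
  have s01: "simplicial_map K L (\<lambda>x. g0 (g1 x))"
    using s0 s1 by (auto simp: simplicial_map_def image_image[symmetric])
  have "(homology_map d K L h :: ('x list \<Rightarrow> 'k) set \<Rightarrow> _) = homology_map d K L (\<lambda>x. g0 (g1 x))"
  proof (rule homology_map_contiguous[OF K L s01 sh])
    fix \<sigma> assume \<sigma>: "\<sigma> \<in> K"
    then have "\<sigma> \<subseteq> X" "finite \<sigma>"
      by (simp_all add: K_def mem_sublevel_VR)
    have hL: "h ` \<sigma> \<in> L"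
      using sh \<sigma> by (simp add: simplicial_map_def)
    have dist: "data_dist \<Phi> (h x) (h y) \<le> fst p" if "x \<in> \<sigma>" "y \<in> \<sigma>" for x y
      using hL that by (simp add: L_def mem_sublevel_VR)
    \<comment> \<open>Mixed pairs are the point: no measurement distinguishes
      \<open>g0 (g1 x)\<close> from \<open>h x\<close>, so either may be replaced by the latter and
      the bound inside the image under \<open>h\<close> applies.\<close>
    have "data_dist \<Phi> u v \<le> fst p"
      if "x \<in> \<sigma>" "y \<in> \<sigma>" "u \<in> {g0 (g1 x), h x}" "v \<in> {g0 (g1 y), h y}" for x y u v
    proof -
      have "data_dist \<Phi> u v = data_dist \<Phi> (h x) (h y)"
        using that \<open>\<sigma> \<subseteq> X\<close> by (intro data_dist_eqI) (auto simp: eq)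
      with dist[OF that(1,2)] show ?thesis
        by simp
    qed
    then show "(\<lambda>x. g0 (g1 x)) ` \<sigma> \<union> h ` \<sigma> \<in> L"
      using hL \<open>\<sigma> \<subseteq> X\<close> \<open>finite \<sigma>\<close> closed eq[OF \<Phi>(2)] by (auto simp: L_def mem_sublevel_VR)
  qed
  with p show ?thesis
    by (simp add: PH_map_def PH_def comp[OF \<Phi>(2)] homology_map_compose[OF K K' s1 s0]
        flip: K_def K'_def L_def)
qed

theorem mainTheorem2:
  fixes X :: "'x set" and \<Phi> :: "('x \<Rightarrow> real) set" and M :: "('x \<Rightarrow> 'x) set" and d :: nat
  assumes "incarnation X \<Phi> M"
  shows "contravariant_graph_functor \<Phi> M (assoc_edges X \<Phi> M)
    (Tame :: ((('k::field, ('x list \<Rightarrow> 'k) set) module,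
               ('x list \<Rightarrow> 'k) set \<Rightarrow> ('x list \<Rightarrow> 'k) set) par_diagram,
              real \<times> real \<Rightarrow> ('x list \<Rightarrow> 'k) set \<Rightarrow> ('x list \<Rightarrow> 'k) set) precategory)
    (PH d X \<Phi>)
    (\<lambda>(\<phi>, g, \<psi>). PH_map d X \<Phi> g \<phi>)"
proof -
  have X: "finite X" and \<Phi>: "finite \<Phi>" and M: "M \<subseteq> data_endos X \<Phi>"
    using assms by (auto simp: incarnation_def data_set_def)
  have endo: "compose X \<phi> g \<in> \<Phi>" if "\<phi> \<in> \<Phi>" "g \<in> M" for \<phi> g
    using M that by (auto simp: data_endos_def)
  have "M \<subseteq> X \<rightarrow>\<^sub>E X"
    using M by (auto simp: data_endos_def)
  then have "finite M"
    using X by (auto intro: finite_subset finite_PiE)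
  then interpret grothendieck_graph \<Phi> M "assoc_edges X \<Phi> M"
    by unfold_locales (auto simp: \<Phi> assoc_edges_def endo)
  interpret category Tame
    by (rule category_Tame)
  show ?thesis
  proof
    show "PH d X \<Phi> \<phi> \<in> Ob Tame" if "\<phi> \<in> \<Phi>" for \<phi>
      using that by (simp add: Tame_def par_functor_PH tame_PH[OF X \<Phi>])
    show "(case (\<phi>, g, \<psi>) of (\<phi>, g, \<psi>) \<Rightarrow> PH_map d X \<Phi> g \<phi>) \<in> Hom Tame (PH d X \<Phi> \<psi>) (PH d X \<Phi> \<phi>)"
      if "(\<phi>, g, \<psi>) \<in> assoc_edges X \<Phi> M" for \<phi> g \<psi>
      using that PH_map_nat_trans[OF \<Phi>, of \<phi> g X d] M by (auto simp: Tame_def assoc_edges_def)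
    fix \<phi>0 \<phi>1 \<phi>2 g0 g1 h
    assume e: "(\<phi>0, g0, \<phi>1) \<in> assoc_edges X \<Phi> M" "(\<phi>1, g1, \<phi>2) \<in> assoc_edges X \<Phi> M"
        "(\<phi>0, h, \<phi>2) \<in> assoc_edges X \<Phi> M"
      and comp: "acts_as_composite \<Phi> (assoc_edges X \<Phi> M) g0 g1 h"
    have \<phi>: "\<phi>0 \<in> \<Phi>" "\<phi>1 = compose X \<phi>0 g0" "\<phi>2 = compose X (compose X \<phi>0 g0) g1"
      and gM: "g0 \<in> M" "g1 \<in> M" "h \<in> M"
      using e by (auto simp: assoc_edges_def)
    \<comment> \<open>For any \<open>\<psi>\<close>, closure of \<open>\<Phi>\<close> under
      \<open>M\<close> supplies the two edges labelled \<open>g0\<close> and \<open>g1\<close> that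
      start at \<open>\<psi>\<close>; \<open>acts_as_composite\<close> then yields the edge labelled
      \<open>h\<close>, which is this equation.\<close>
    have "compose X \<psi> h = compose X (compose X \<psi> g0) g1" if "\<psi> \<in> \<Phi>" for \<psi>
      using comp that endo gM unfolding acts_as_composite_def assoc_edges_def by simp
    from PH_map_compose[OF \<Phi> \<phi>(1) subsetD[OF M gM(1)] subsetD[OF M gM(2)] subsetD[OF M gM(3)] this]
    have "PH_map d X \<Phi> h \<phi>0 = Cmp Tame (PH d X \<Phi> \<phi>2) (PH d X \<Phi> \<phi>1) (PH d X \<Phi> \<phi>0)
        (PH_map d X \<Phi> g0 \<phi>0) (PH_map d X \<Phi> g1 \<phi>1)"
      unfolding \<phi>(2,3)
      by (intro extensionalityI[of _ par]) (simp_all add: Tame_def PH_map_def)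
    then show "(case (\<phi>0, h, \<phi>2) of (\<phi>, g, \<psi>) \<Rightarrow> PH_map d X \<Phi> g \<phi>) =
        Cmp Tame (PH d X \<Phi> \<phi>2) (PH d X \<Phi> \<phi>1) (PH d X \<Phi> \<phi>0)
          (case (\<phi>0, g0, \<phi>1) of (\<phi>, g, \<psi>) \<Rightarrow> PH_map d X \<Phi> g \<phi>)
          (case (\<phi>1, g1, \<phi>2) of (\<phi>, g, \<psi>) \<Rightarrow> PH_map d X \<Phi> g \<phi>)"
      by simp
  qed
qed

end
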